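(* Let $\omega=\omega_{\boldsymbol{c}}\cup\omega_E$ be a triangulated corner patch, that is, let $\mathscr{P}$ be a triangulation obtained by dividing each rectangle of a corner patch (see context) into two triangles of equal area, where (i) the partition of $\omega_{\boldsymbol{c}}$ is such that the pair $\boldsymbol{V}_{\mathscr{P}}(\omega_{\boldsymbol{c}})\times M_{\mathscr{P}}(\omega_{\boldsymbol{c}})$ is (uniformly) inf-sup stable with a constant $\beta_{\boldsymbol{c}}>0$; (ii) in the rectangular partition, the "overlapped" edge patch $\omega_E$ contains at least one division orthogonal to its "long and thin" elements; more precisely, every "long and thin" element is divided into two "long and thin" elements by such a division. Here $M_{\mathscr{P}}$ and $\boldsymbol{V}_{\mathscr{P}}$ are the continuous $\mathbb{P}_1$ pressure and $\mathbb{P}_2$ velocity spaces. Let $\beta>0$ be the inf-sup constant, independent of the shape and size of the elements, that triangulated edge patches satisfying (ii) possess (see context). Then there exists $\beta_{\mathscr{P}}>0$, depending only on $\beta$ and $\beta_{\boldsymbol{c}}$, such that $$\inf_{0\neq q\in M_{\mathscr{P}}(\omega)}\ \sup_{\boldsymbol{0}\neq\boldsymbol{v}\in \boldsymbol{V}_{\mathscr{P}}(\omega)}\ \frac{\int_\omega q\,\operatorname{div}\boldsymbol{v}\,\mathrm{d}\boldsymbol{x}}{|\boldsymbol{v}|_{1,\omega}\,\|q\|_{0,\omega}}\ \ge\ \beta_{\mathscr{P}} .$$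
   Context: **Spaces.** For a set $D$ that is a union of triangles of a conforming triangulation $\mathscr{P}$, $\mathbb{P}_\ell(K)$ is the space of polynomials on $K$ of total degree at most $\ell$. $M_{\mathscr{P}}(D)$ is the space of functions $q$ continuous on $D$, belonging to $\mathbb{P}_1(K)$ on each triangle $K\subseteq D$, with $\int_D q=0$. $\boldsymbol{V}_{\mathscr{P}}(D)$ is the space of continuous vector fields $\boldsymbol{v}:D\to\mathbb{R}^2$ with $\boldsymbol{v}|_K\in\mathbb{P}_2(K)^2$ on each triangle $K\subseteq D$ and $\boldsymbol{v}=\boldsymbol{0}$ on $\partial D$. $\|\cdot\|_{0,D}$ is the $L^2(D)$ norm and $|\boldsymbol{v}|_{1,D}=\|\nabla\boldsymbol{v}\|_{0,D}$. The pair $\boldsymbol{V}_{\mathscr{P}}(D)\times M_{\mathscr{P}}(D)$ is inf-sup stable with constant $b$ if $\inf_{q}\sup_{\boldsymbol{v}}\int_D q\operatorname{div}\boldsymbol{v}\,\mathrm{d}\boldsymbol{x}/(|\boldsymbol{v}|_{1,D}\|q\|_{0,D})\ge b$ over nonzero $q\in M_{\mathscr{P}}(D)$, $\boldsymbol{v}\in\boldsymbol{V}_{\mathscr{P}}(D)$. **Corner patches (rectangular partitions before triangulating).** A coarse corner patch is a shape-regular rectangle divided by one line parallel to each pair of sides into four cells: a small shape-regular cell $C$ at one vertex, two long and thin cells each sharing an edge with $C$, and a large shape-regular cell. A corner patch $\omega$ is obtained by subdividing the cells of such a coarse patch, or of a patch formed by joining several of them around the common vertex of their small cells. It is decomposed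 as $\omega=\omega_{\boldsymbol{c}}\cup\omega_E$, where $\omega_{\boldsymbol{c}}$ is the small shape-regular region (the small cell, or the union of the small cells) and $\omega_E$, the "overlapped" edge patch, is the union of all the remaining cells. Each long and thin coarse cell is divided into two long and thin elements (by one division orthogonal to its long side), or into four (if it is also bisected along its length); further uniform refinement of the patch is not considered. **The constant $\beta$.** Triangulated edge patches satisfying (ii) are uniformly inf-sup stable for the $\mathbb{P}_2$–$\mathbb{P}_1$ pair: there is $\beta>0$, independent of the shape and size of the elements, such that $\boldsymbol{V}_{\mathscr{P}}(\omega_E)\times M_{\mathscr{P}}(\omega_E)$ is inf-sup stable with constant $\beta$. *)

theory Defs
  imports "HOL-Analysis.Analysis"
begin

section \<open>Taylor--Hood spaces and the inf-sup constant\<close>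

definition poly_on :: "nat \<Rightarrow> (real^2) set \<Rightarrow> (real^2 \<Rightarrow> real) set" where
  "poly_on l K =
     {f. \<exists>c :: nat \<Rightarrow> nat \<Rightarrow> real.
           \<forall>x\<in>K. f x = (\<Sum>i\<le>l. \<Sum>j\<le>l - i. c i j * (x$1)^i * (x$2)^j)}"

text \<open>
  Functions on \<open>D\<close> are represented by functions on the whole plane; only their values on \<open>D\<close>
  are constrained, and all notions below depend only on these values (derivatives matter only
  almost everywhere in \<open>D\<close>). Accordingly, being nonzero means being nonzero somewhere on \<open>D\<close>.
\<close>

definition pressure_space :: "(real^2) set set \<Rightarrow> (real^2) set \<Rightarrow> (real^2 \<Rightarrow> real) set" where
  "pressure_space P D =
     {q. continuous_on D q \<and> (\<forall>K\<in>P. K \<subseteq> D \<longrightarrow> q \<in> poly_on 1 K) \<and> integral D q = 0}"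

definition velocity_space :: "(real^2) set set \<Rightarrow> (real^2) set \<Rightarrow> (real^2 \<Rightarrow> real^2) set" where
  "velocity_space P D =
     {v. continuous_on D v \<and> (\<forall>K\<in>P. K \<subseteq> D \<longrightarrow> (\<forall>i. (\<lambda>x. v x $ i) \<in> poly_on 2 K)) \<and>
         (\<forall>x\<in>frontier D. v x = 0)}"

definition nonzero_on :: "'a set \<Rightarrow> ('a \<Rightarrow> 'b::zero) \<Rightarrow> bool" where
  "nonzero_on D f \<longleftrightarrow> (\<exists>x\<in>D. f x \<noteq> 0)"

text \<open>
  The derivative of a piecewise polynomial field need not exist on the edges of the triangles,
  where \<^const>\<open>jacobian\<close> is unspecified; this is a null set and does not affect the integrals.
\<close>

definition divergence :: "(real^2 \<Rightarrow> real^2) \<Rightarrow> real^2 \<Rightarrow> real" where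
  "divergence v x = trace (jacobian v (at x))"

definition L2_norm_on :: "(real^2) set \<Rightarrow> (real^2 \<Rightarrow> 'b::real_normed_vector) \<Rightarrow> real" where
  "L2_norm_on D f = sqrt (integral D (\<lambda>x. (norm (f x))\<^sup>2))"

text \<open>The norm of the type of matrices is the Frobenius norm.\<close>

definition H1_seminorm_on :: "(real^2) set \<Rightarrow> (real^2 \<Rightarrow> real^2) \<Rightarrow> real" where
  "H1_seminorm_on D v = L2_norm_on D (\<lambda>x. jacobian v (at x))"

text \<open>
  The infimum and supremum are taken in the extended reals, where a supremum over the empty set
  is \<open>-\<infinity>\<close>: a trivial velocity space is never inf-sup stable unless the pressure space is trivial.
\<close>

definition inf_sup :: "(real^2) set set \<Rightarrow> (real^2) set \<Rightarrow> ereal" where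
  "inf_sup P D =
     (INF q \<in> {q \<in> pressure_space P D. nonzero_on D q}.
        SUP v \<in> {v \<in> velocity_space P D. nonzero_on D v}.
          ereal (integral D (\<lambda>x. q x * divergence v x) /
                 (H1_seminorm_on D v * L2_norm_on D q)))"

definition inf_sup_stable :: "(real^2) set set \<Rightarrow> (real^2) set \<Rightarrow> real \<Rightarrow> bool" where
  "inf_sup_stable P D b \<longleftrightarrow> ereal b \<le> inf_sup P D"

section \<open>Corner patches\<close>

text \<open>
  A corner patch is described by the partitions that it induces on the (at most four) half-axes
  emanating from the common vertex of the small cells. A half-axis \<open>h\<close> starts at \<open>0\<close>, the small
  cell ends at \<open>small h\<close>, the coarse patch ends at \<open>extent h\<close>, the division orthogonal to
  the half-axis is at \<open>division h\<close>, and \<open>bisected h\<close> tells whether the segment of the small cell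
  (hence also the thin cells having it as short side) is bisected.
  Because the partition into rectangles has no hanging nodes, the partition of each
  coarse patch is the product of the partitions of its two half-axes, and coarse patches
  joined along a half-axis induce the same partition on it. In particular, the partition of the
  large cells follows from that of the thin ones.
\<close>

record half_axis =
  small :: real
  division :: real
  extent :: real
  bisected :: bool

definition inner_segments :: "half_axis \<Rightarrow> (real \<times> real) set" where
  "inner_segments h =
     (if bisected h then {(0, small h / 2), (small h / 2, small h)} else {(0, small h)})"

definition outer_segments :: "half_axis \<Rightarrow> (real \<times> real) set" where
  "outer_segments h = {(small h, division h), (division h, extent h)}"

text \<open>
  A quadrant \<open>s\<close> chooses for each of the two directions the positive (\<open>True\<close>) or the negative
  half-axis; \<open>H i b\<close> is the half-axis in direction \<open>i\<close> on side \<open>b\<close>.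
\<close>

type_synonym quadrant = "2 \<Rightarrow> bool"

type_synonym axes = "2 \<Rightarrow> bool \<Rightarrow> half_axis"

definition cell :: "quadrant \<Rightarrow> (2 \<Rightarrow> real \<times> real) \<Rightarrow> (real^2) set" where
  "cell s I =
     {x. \<forall>i. fst (I i) \<le> (if s i then x$i else - x$i) \<and> (if s i then x$i else - x$i) \<le> snd (I i)}"

text \<open>
  The position of the patch in the plane is given by a map \<open>\<phi>\<close>, which will be a rigid motion.
\<close>

definition corner_rectangles :: "(real^2 \<Rightarrow> real^2) \<Rightarrow> axes \<Rightarrow> quadrant set \<Rightarrow> (real^2) set set" where
  "corner_rectangles \<phi> H S =
     {\<phi> ` cell s I | s I. s \<in> S \<and> (\<forall>i. I i \<in> inner_segments (H i (s i)))}"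

definition edge_rectangles :: "(real^2 \<Rightarrow> real^2) \<Rightarrow> axes \<Rightarrow> quadrant set \<Rightarrow> (real^2) set set" where
  "edge_rectangles \<phi> H S =
     {\<phi> ` cell s I | s I. s \<in> S \<and>
        (\<forall>i. I i \<in> inner_segments (H i (s i)) \<union> outer_segments (H i (s i))) \<and>
        (\<exists>i. I i \<in> outer_segments (H i (s i)))}"

definition corner_region :: "(real^2 \<Rightarrow> real^2) \<Rightarrow> axes \<Rightarrow> quadrant set \<Rightarrow> (real^2) set" where
  "corner_region \<phi> H S = \<Union> (corner_rectangles \<phi> H S)"

definition edge_region :: "(real^2 \<Rightarrow> real^2) \<Rightarrow> axes \<Rightarrow> quadrant set \<Rightarrow> (real^2) set" where
  "edge_region \<phi> H S = \<Union> (edge_rectangles \<phi> H S)"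

definition shape_regular :: "real \<Rightarrow> real \<Rightarrow> real \<Rightarrow> bool" where
  "shape_regular \<kappa> a b \<longleftrightarrow> 0 < a \<and> 0 < b \<and> a \<le> \<kappa> * b \<and> b \<le> \<kappa> * a"

text \<open>No threshold on the aspect ratio is imposed, so that any stricter meaning is covered.\<close>

definition long_and_thin :: "real \<Rightarrow> real \<Rightarrow> bool" where
  "long_and_thin len width \<longleftrightarrow> 0 < width \<and> width < len"

text \<open>
  The last condition says that the coarse patches are joined along common half-axes: two coarse
  patches in opposite quadrants are accompanied by one in a quadrant between them.
\<close>

definition corner_patch :: "real \<Rightarrow> (real^2 \<Rightarrow> real^2) \<Rightarrow> axes \<Rightarrow> quadrant set \<Rightarrow> bool" where
  "corner_patch \<kappa> \<phi> H S \<longleftrightarrow>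
     (\<exists>p f. orthogonal_transformation f \<and> \<phi> = (\<lambda>x. p + f x)) \<and>
     S \<noteq> {} \<and>
     (\<forall>s\<in>S.
        shape_regular \<kappa> (extent (H 1 (s 1))) (extent (H 2 (s 2))) \<and>
        shape_regular \<kappa> (small (H 1 (s 1))) (small (H 2 (s 2))) \<and>
        shape_regular \<kappa> (extent (H 1 (s 1)) - small (H 1 (s 1)))
                        (extent (H 2 (s 2)) - small (H 2 (s 2))) \<and>
        (\<forall>i j. i \<noteq> j \<longrightarrow>
           long_and_thin (extent (H i (s i)) - small (H i (s i))) (small (H j (s j)))) \<and>
        (\<forall>i. small (H i (s i)) < division (H i (s i)) \<and>
             division (H i (s i)) < extent (H i (s i)))) \<and>
     (\<forall>s\<in>S. \<forall>t\<in>S. (\<forall>i. s i \<noteq> t i) \<longrightarrow> (\<exists>r\<in>S. r \<noteq> s \<and> r \<noteq> t))"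

text \<open>
  Each long and thin coarse cell, which is outer in its long direction \<open>i\<close> and inner in the other
  direction \<open>j\<close>, is divided orthogonally to its long side into long and thin elements.
\<close>

definition thin_cells_divided :: "axes \<Rightarrow> quadrant set \<Rightarrow> bool" where
  "thin_cells_divided H S \<longleftrightarrow>
     (\<forall>s\<in>S. \<forall>i j. i \<noteq> j \<longrightarrow>
        (\<forall>(a, b) \<in> outer_segments (H i (s i)). \<forall>(c, d) \<in> inner_segments (H j (s j)).
           long_and_thin (b - a) (d - c)))"

text \<open>
  \<^const>\<open>triangulation\<close> includes conformity: two members meet in a common face or not at all.
\<close>

definition triangulates :: "(real^2) set set \<Rightarrow> (real^2) set set \<Rightarrow> bool" where
  "triangulates P R \<longleftrightarrow>
     triangulation P \<and> (\<forall>K\<in>P. 2 simplex K) \<and> (\<forall>K\<in>P. \<exists>Q\<in>R. K \<subseteq> Q) \<and>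
     (\<forall>Q\<in>R. \<exists>K L. K \<noteq> L \<and> {T\<in>P. T \<subseteq> Q} = {K, L} \<and> K \<union> L = Q \<and>
        measure lebesgue K = measure lebesgue L)"

end

theory Submission
  imports Defs
begin

text \<open>
  Let \<open>q\<close> be a pressure on the patch \<open>D \<union> E\<close>, where \<open>D\<close> is the corner region and \<open>E\<close> the edge
  region, and let \<open>a\<close> and \<open>b\<close> be its mean values over \<open>D\<close> and \<open>E\<close>. The restrictions of \<open>q - a\<close>
  to \<open>D\<close> and of \<open>q - b\<close> to \<open>E\<close> are pressures of the two parts, so that the two given inf-sup
  conditions provide velocities testing them. Extended by zero, such a velocity is a velocity of
  the whole patch with the same seminorm, and it does not see the subtracted constant, because
  the divergence of a field vanishing on the boundary has integral zero. It remains to bound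
  \<open>\<parallel>q\<parallel>\<close> by the larger of the deviations \<open>\<parallel>q - a\<parallel>\<close> on \<open>D\<close> and \<open>\<parallel>q - b\<parallel>\<close> on \<open>E\<close>, with a constant
  that knows nothing about the shape of the elements.

  This bound rests on the continuity of \<open>q\<close>. Controlling the piecewise constant part of \<open>q\<close> by a
  velocity with flux through the interface would be costly, because such a velocity must extend
  into the long and thin elements and has a large seminorm there. Instead, \<open>q\<close> has a single value
  at a point \<open>z\<close> common to a triangle \<open>K\<close> of \<open>D\<close> and a triangle \<open>K'\<close> of \<open>E\<close>. The value at \<open>z\<close> of
  an affine function on \<open>K\<close> is bounded, up to an absolute constant, by its \<open>L\<^sup>2\<close> norm on \<open>K\<close> divided by the square root
  of the area of \<open>K\<close> (lemma \<open>affine_value_le_integral\<close>), hence \<open>a - b\<close> is bounded by the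
  deviations. Since \<open>q\<close> has mean value zero, its piecewise constant part has squared norm at most
  \<open>\<bar>D\<bar> (a - b)\<^sup>2\<close>, where \<open>\<bar>D\<bar>\<close> is the area of \<open>D\<close> (lemma \<open>square_norm_le_deviations\<close>). So all that
  the geometry has to provide is that the areas of \<open>K\<close> and \<open>K'\<close> are at least a fixed fraction of
  the area of \<open>D\<close>.

  For \<open>z\<close> the corner opposite to the origin of the largest small cell is taken, for \<open>K\<close> a triangle
  in the rectangle of that cell at \<open>z\<close>, and for \<open>K'\<close> a triangle in the rectangle of the large
  cell at \<open>z\<close>. The divisions orthogonal to the long and thin cells cut that rectangle off the
  large cell; as the resulting thin elements are still longer than they are wide, its area is not much
  smaller than that of the small cell (lemma \<open>corner_edge_common_point\<close>).
\<close>

section \<open>Lipschitz continuity of piecewise polynomials\<close>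

lemma poly_on_real_polynomial:
  assumes "f \<in> poly_on l K"
  shows "\<exists>g. real_polynomial_function g \<and> (\<forall>x\<in>K. f x = g x)"
proof -
  obtain c :: "nat \<Rightarrow> nat \<Rightarrow> real" where
    c: "\<forall>x\<in>K. f x = (\<Sum>i\<le>l. \<Sum>j\<le>l - i. c i j * (x$1)^i * (x$2)^j)"
    using assms by (auto simp: poly_on_def)
  have "real_polynomial_function (\<lambda>x::real^2. x $ k)" for k
    by (intro real_polynomial_function.intros(1) bounded_linear_vec_nth)
  then have "real_polynomial_function (\<lambda>x. \<Sum>i\<le>l. \<Sum>j\<le>l - i. c i j * (x$1)^i * (x$2)^j)"
    by (intro real_polynomial_function_sum real_polynomial_function.intros(2,4)
        real_polynomial_function_power) auto
  then show ?thesis using c by blast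
qed

lemma real_polynomial_lipschitz:
  fixes g :: "'a::euclidean_space \<Rightarrow> real"
  assumes "real_polynomial_function g" "compact K"
  shows "\<exists>L. L-lipschitz_on K g"
  using assms(1)
proof induction
  case (linear f)
  then interpret bounded_linear f .
  show ?case using lipschitz_boundE[of K] by metis
next
  case (const c)
  show ?case using lipschitz_on_constant by blast
next
  case (add f g)
  then show ?case using lipschitz_on_add by blast
next
  case (mult f g)
  then obtain L M where L: "L-lipschitz_on K f" and M: "M-lipschitz_on K g" by blast
  have "bounded (f ` K)" "bounded (g ` K)"
    using assms(2) lipschitz_on_continuous_on[OF L] lipschitz_on_continuous_on[OF M]
    by (auto intro!: compact_imp_bounded compact_continuous_image)
  then obtain a b where a: "\<And>x. x \<in> K \<Longrightarrow> \<bar>f x\<bar> \<le> a" and b: "\<And>x. x \<in> K \<Longrightarrow> \<bar>g x\<bar> \<le> b"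
    by (auto simp: bounded_iff)
  have "(\<bar>a\<bar> * M + \<bar>b\<bar> * L)-lipschitz_on K (\<lambda>x. f x * g x)"
  proof (rule lipschitz_onI)
    show "0 \<le> \<bar>a\<bar> * M + \<bar>b\<bar> * L"
      using lipschitz_on_nonneg[OF L] lipschitz_on_nonneg[OF M] by simp
    fix x y assume xy: "x \<in> K" "y \<in> K"
    have "\<bar>f x * g x - f y * g y\<bar> = \<bar>f x * (g x - g y) + g y * (f x - f y)\<bar>"
      by (simp add: algebra_simps)
    also have "\<dots> \<le> \<bar>f x\<bar> * \<bar>g x - g y\<bar> + \<bar>g y\<bar> * \<bar>f x - f y\<bar>"
      using abs_triangle_ineq by (metis abs_mult)
    also have "\<dots> \<le> \<bar>a\<bar> * (M * dist x y) + \<bar>b\<bar> * (L * dist x y)"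
      using a[of x] b[of y] lipschitz_onD[OF L, of x y] lipschitz_onD[OF M, of x y] xy
      by (intro add_mono mult_mono) (auto simp: dist_real_def)
    finally show "dist (f x * g x) (f y * g y) \<le> (\<bar>a\<bar> * M + \<bar>b\<bar> * L) * dist x y"
      by (simp add: dist_real_def algebra_simps)
  qed
  then show ?case by blast
qed

text \<open>
  The pieces need not be convex: the segment between two points is covered by the finitely many
  closed preimages of the pieces, and Lipschitz bounds on closed subsets of an interval that
  cover it combine to a bound on the interval.
\<close>

lemma lipschitz_on_closed_cover:
  fixes f :: "'a::real_normed_vector \<Rightarrow> 'b::metric_space"
  assumes "finite \<U>" "\<And>U. U \<in> \<U> \<Longrightarrow> closed U" "\<Union>\<U> = UNIV"
    and lip: "\<And>U. U \<in> \<U> \<Longrightarrow> \<exists>L. L-lipschitz_on U f"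
  shows "\<exists>L. L-lipschitz_on UNIV f"
proof -
  obtain l where l: "\<And>U. U \<in> \<U> \<Longrightarrow> (l U)-lipschitz_on U f"
    using lip by metis
  define L where "L = (\<Sum>U\<in>\<U>. \<bar>l U\<bar>)"
  have L: "L-lipschitz_on U f" if "U \<in> \<U>" for U
    using lipschitz_on_le[OF l[OF that], of L] member_le_sum[of U \<U> "\<lambda>U. \<bar>l U\<bar>"] that assms(1)
    by (auto simp: L_def)
  have L0: "0 \<le> L" by (simp add: L_def sum_nonneg)
  have "L-lipschitz_on UNIV f"
  proof (rule lipschitz_onI)
    fix x y :: 'a
    define p where "p = (\<lambda>t. x + t *\<^sub>R (y - x))"
    have p: "(norm (y - x))-lipschitz_on T p" for T
      by (rule lipschitz_onI) (auto simp: p_def dist_norm simp flip: scaleR_diff_left)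
    have "(L * norm (y - x))-lipschitz_on {0..1} (f \<circ> p)"
    proof (rule lipschitz_on_closed_Union[where I = \<U> and U = "\<lambda>U. p -` U"])
      fix U assume U: "U \<in> \<U>"
      show "(L * norm (y - x))-lipschitz_on (p -` U) (f \<circ> p)"
        using L[OF U] by (intro lipschitz_on_compose p) (auto intro: lipschitz_on_subset)
      show "closed (p -` U)"
        using lipschitz_on_continuous_on[OF p[of UNIV]] assms(2)[OF U] closed_vimage by blast
    next
      show "{0..1} \<subseteq> (\<Union>U\<in>\<U>. p -` U)"
        using assms(3) by (metis subset_UNIV vimage_UNIV vimage_Union)
    qed (use assms L0 in auto)
    from lipschitz_onD[OF this, of 0 1] show "dist (f x) (f y) \<le> L * dist x y"
      by (simp add: p_def dist_norm norm_minus_commute)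
  qed (rule L0)
  then show ?thesis ..
qed

section \<open>Integrals of continuous functions\<close>

lemma continuous_on_compact_integrable:
  fixes f :: "'a::euclidean_space \<Rightarrow> 'b::euclidean_space"
  assumes "compact K" "continuous_on K f"
  shows "f absolutely_integrable_on K"
  using borel_integrable_compact[OF assms] assms(1)
  by (simp add: set_integrable_def integrable_completion borel_measurable_integrable indicator_scaleR_eq_if)

lemma integral_compact_lborel:
  fixes f :: "'a::euclidean_space \<Rightarrow> real"
  assumes "compact K" "continuous_on K f"
  shows "integrable lborel (\<lambda>x. indicator K x * f x)"
    and "(\<integral>x. indicator K x * f x \<partial>lborel) = integral K f"
proof -
  show *: "integrable lborel (\<lambda>x. indicator K x * f x)"
    using borel_integrable_compact[OF assms] by simp
  then have "set_integrable lborel K f" by (simp add: set_integrable_def)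
  from set_borel_integral_eq_integral(2)[OF this]
  show "(\<integral>x. indicator K x * f x \<partial>lborel) = integral K f"
    by (simp add: set_lebesgue_integral_def)
qed

lemma integral_shift:
  fixes f :: "'a::euclidean_space \<Rightarrow> real"
  assumes "continuous_on UNIV f"
  shows "(\<integral>x. f (c + x) \<partial>lborel) = (\<integral>x. f x \<partial>lborel)"
proof -
  have "(\<integral>x. f x \<partial>lborel) = (\<integral>x. f x \<partial>distr lborel borel ((+) c))"
    by (simp add: lborel_distr_plus)
  also have "\<dots> = (\<integral>x. f (c + x) \<partial>lborel)"
    using borel_measurable_continuous_onI[OF assms] by (subst integral_distr) auto
  finally show ?thesis by simp
qed

section \<open>The integral of the divergence\<close>

lemma difference_quotient_tendsto:
  fixes w :: "real^'n \<Rightarrow> real^'m"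
  assumes "w differentiable (at x)"
  shows "(\<lambda>k. (w (x + inverse (real (Suc k)) *\<^sub>R v) $ i - w x $ i) / inverse (real (Suc k)))
           \<longlonglongrightarrow> frechet_derivative w (at x) v $ i"
proof -
  let ?F = "\<lambda>t. w (x + t *\<^sub>R v) $ i"
  have d: "(w has_derivative frechet_derivative w (at x)) (at (x + 0 *\<^sub>R v))"
    using assms by (simp add: frechet_derivative_works)
  have "((\<lambda>t::real. x + t *\<^sub>R v) has_derivative (\<lambda>t. t *\<^sub>R v)) (at 0)"
    by (auto intro!: derivative_eq_intros)
  from has_derivative_compose[OF this d]
  have "((\<lambda>t. w (x + t *\<^sub>R v)) has_derivative (\<lambda>t. frechet_derivative w (at x) (t *\<^sub>R v))) (at 0)" .
  then have "(?F has_derivative (\<lambda>t. frechet_derivative w (at x) (t *\<^sub>R v) $ i)) (at 0)"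
    by (rule bounded_linear.has_derivative[OF bounded_linear_vec_nth])
  moreover have "(\<lambda>t. frechet_derivative w (at x) (t *\<^sub>R v) $ i) = (*) (frechet_derivative w (at x) v $ i)"
    using linear_frechet_derivative[OF assms] by (auto simp: linear_cmul)
  ultimately have "DERIV ?F 0 :> frechet_derivative w (at x) v $ i"
    by (simp add: has_field_derivative_def)
  then have "((\<lambda>h. (?F h - ?F 0) / h) \<longlongrightarrow> frechet_derivative w (at x) v $ i) (at 0)"
    by (simp add: DERIV_def)
  moreover have "filterlim (\<lambda>k. inverse (real (Suc k))) (at 0) sequentially"
    using LIMSEQ_inverse_real_of_nat by (auto simp: filterlim_at)
  ultimately show ?thesis
    by (auto dest: filterlim_compose)
qed

text \<open>
  The integral of the divergence of a compactly supported Lipschitz field is computed without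
  Fubini's theorem and without integrating by parts on each triangle: difference quotients have
  integral zero by translation invariance, and they converge boundedly to the divergence. The
  step size is \<open>1 / (k + 1)\<close>.
\<close>

definition shift_divergence :: "(real^2 \<Rightarrow> real^2) \<Rightarrow> nat \<Rightarrow> real^2 \<Rightarrow> real" where
  "shift_divergence w k x =
     (\<Sum>i\<in>UNIV. (w (x + inverse (real (Suc k)) *\<^sub>R axis i 1) $ i - w x $ i) / inverse (real (Suc k)))"

lemma shift_divergence_tendsto:
  assumes "w differentiable (at x)"
  shows "(\<lambda>k. shift_divergence w k x) \<longlonglongrightarrow> divergence w x"
  unfolding shift_divergence_def divergence_def jacobian_def trace_def matrix_def
  by (simp only: vec_lambda_beta, intro tendsto_sum difference_quotient_tendsto[OF assms])

lemma shift_divergence_bound: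
  assumes "L-lipschitz_on UNIV w"
  shows "\<bar>shift_divergence w k x\<bar> \<le> 2 * L"
proof -
  have "\<bar>(w (x + inverse (real (Suc k)) *\<^sub>R axis i 1) $ i - w x $ i) / inverse (real (Suc k))\<bar> \<le> L" for i
  proof -
    define c where "c = inverse (real (Suc k))"
    have c: "0 < c" by (simp add: c_def)
    let ?y = "x + c *\<^sub>R axis i 1"
    have "\<bar>w ?y $ i - w x $ i\<bar> \<le> norm (w ?y - w x)"
      using component_le_norm_cart[of "w ?y - w x" i] by simp
    also have "\<dots> \<le> L * norm (?y - x)"
      using lipschitz_on_normD[OF assms] by blast
    also have "norm (?y - x) = c"
      using c by simp
    finally show ?thesis
      unfolding c_def[symmetric] using c by (simp add: pos_divide_le_eq)
  qed
  then have "\<bar>shift_divergence w k x\<bar> \<le> (\<Sum>i\<in>(UNIV::2 set). L)"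
    unfolding shift_divergence_def by (intro order_trans[OF sum_abs] sum_mono) auto
  then show ?thesis by simp
qed

lemma continuous_shift_divergence:
  assumes "L-lipschitz_on UNIV w"
  shows "continuous_on A (shift_divergence w k)"
proof -
  have w: "continuous_on UNIV w" using assms by (rule lipschitz_on_continuous_on)
  show ?thesis unfolding shift_divergence_def[abs_def]
    by (intro continuous_intros continuous_on_compose2[OF w] continuous_on_subset[OF w]) auto
qed

text \<open>
  Besides the limit, this provides the integrability of products with the divergence, which the
  splitting of integrals below requires.
\<close>

lemma divergence_dominated:
  assumes w: "L-lipschitz_on UNIV w" "negligible N" "\<And>x. x \<notin> N \<Longrightarrow> w differentiable (at x)"
    and D: "compact D" "continuous_on D g"
  shows integrable_mult_divergence: "(\<lambda>x. g x * divergence w x) integrable_on D"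
    and integral_mult_divergence_tendsto:
      "(\<lambda>k. integral D (\<lambda>x. g x * shift_divergence w k x)) \<longlonglongrightarrow> integral D (\<lambda>x. g x * divergence w x)"
proof -
  have eq: "integral (D - N) f = integral D f" "f integrable_on (D - N) \<longleftrightarrow> f integrable_on D"
    for f :: "real^2 \<Rightarrow> real"
  proof -
    show "integral (D - N) f = integral D f"
      by (rule integral_spike_set) (auto intro: negligible_subset[OF w(2)])
    show "f integrable_on (D - N) \<longleftrightarrow> f integrable_on D"
      by (rule integrable_spike_set_eq) (auto intro: negligible_subset[OF w(2)])
  qed
  obtain G where G: "\<And>x. x \<in> D \<Longrightarrow> \<bar>g x\<bar> \<le> G"
    using compact_imp_bounded[OF compact_continuous_image[OF D(2,1)]] by (auto simp: bounded_iff)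
  have f: "(\<lambda>x. g x * shift_divergence w k x) integrable_on (D - N)" for k
    unfolding eq using D continuous_shift_divergence[OF w(1)]
    by (intro set_lebesgue_integral_eq_integral(1) continuous_on_compact_integrable continuous_intros)
  have h: "(\<lambda>x. G * (2 * L)) integrable_on (D - N)"
    unfolding eq using D by (intro set_lebesgue_integral_eq_integral(1) continuous_on_compact_integrable continuous_intros)
  have le: "norm (g x * shift_divergence w k x) \<le> G * (2 * L)" if "x \<in> D - N" for k x
    using G[of x] shift_divergence_bound[OF w(1), of k x] that
    by (auto simp: abs_mult intro!: mult_mono)
  have conv: "(\<lambda>k. g x * shift_divergence w k x) \<longlonglongrightarrow> g x * divergence w x" if "x \<in> D - N" for x
    using that w(3) by (intro tendsto_intros shift_divergence_tendsto) auto
  show "(\<lambda>x. g x * divergence w x) integrable_on D"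
    using dominated_convergence(1)[OF f h le conv] by (simp add: eq)
  show "(\<lambda>k. integral D (\<lambda>x. g x * shift_divergence w k x)) \<longlonglongrightarrow> integral D (\<lambda>x. g x * divergence w x)"
    using dominated_convergence(2)[OF f h le conv] by (simp add: eq)
qed

lemma divergence_local:
  assumes "open U" "x \<in> U" "\<And>y. y \<in> U \<Longrightarrow> v y = w y"
  shows jacobian_local: "jacobian v (at x) = jacobian w (at x)"
    and "divergence v x = divergence w x"
proof -
  have "(v has_derivative f) (at x) \<longleftrightarrow> (w has_derivative f) (at x)" for f
    using assms has_derivative_transform_within_open[of v f x UNIV U w]
      has_derivative_transform_within_open[of w f x UNIV U v] by auto
  then show "jacobian v (at x) = jacobian w (at x)"
    by (simp add: jacobian_def frechet_derivative_def)
  then show "divergence v x = divergence w x" by (simp add: divergence_def)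
qed

lemma jacobian_zero: "jacobian (\<lambda>_. 0 :: real^'m) (at x) = 0"
  by (simp add: jacobian_def frechet_derivative_const matrix_def vec_eq_iff)

lemma divergence_zero: "divergence (\<lambda>_. 0) x = 0"
  by (simp add: divergence_def jacobian_zero trace_def)

text \<open>
  The argument takes place on a ball that contains all translates of the support by at most
  a unit, so that translation moves no mass out of the domain of integration.
\<close>

lemma integral_divergence_eq_0:
  assumes w: "L-lipschitz_on UNIV w" "negligible N" "\<And>x. x \<notin> N \<Longrightarrow> w differentiable (at x)"
    and D: "compact D" "\<And>x. x \<notin> D \<Longrightarrow> w x = 0"
  shows "integral D (divergence w) = 0"
proof -
  have cont: "continuous_on A w" for A
    using w(1) by (meson continuous_on_subset lipschitz_on_continuous_on subset_UNIV)
  obtain R where R: "\<And>x. x \<in> D \<Longrightarrow> norm x \<le> R"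
    using compact_imp_bounded[OF D(1)] by (auto simp: bounded_iff)
  define B where "B = cball (0::real^2) (R + 1)"
  have DB: "D \<subseteq> B" using R by (fastforce simp: B_def)
  have "integral B (shift_divergence w k) = 0" for k
  proof -
    define c where "c = inverse (real (Suc k))"
    have shift: "shift_divergence w k = (\<lambda>x. \<Sum>i\<in>UNIV. (w (x + c *\<^sub>R axis i 1) $ i - w x $ i) / c)"
      by (simp only: shift_divergence_def[abs_def] c_def)
    have c: "0 < c" "c \<le> 1" by (auto simp: c_def inverse_le_1_iff)
    have supp: "w (x + c *\<^sub>R axis i 1) = 0" "w x = 0" if "x \<notin> B" for x :: "real^2" and i
    proof -
      have "norm x \<le> norm (x + c *\<^sub>R axis i 1) + norm (c *\<^sub>R (axis i 1 :: real^2))"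
        by (metis add_diff_cancel_right' norm_triangle_ineq4)
      then have "x + c *\<^sub>R axis i 1 \<notin> D"
        using R[of "x + c *\<^sub>R axis i 1"] that c by (auto simp: B_def)
      then show "w (x + c *\<^sub>R axis i 1) = 0" by (rule D(2))
      show "w x = 0" using that DB by (auto intro: D(2))
    qed
    have int: "integrable lborel f" "integral B f = (\<integral>x. f x \<partial>lborel)"
      if f: "continuous_on UNIV f" "\<And>x. x \<notin> B \<Longrightarrow> f x = 0" for f :: "real^2 \<Rightarrow> real"
    proof -
      have "(\<lambda>x. indicator B x * f x) = f" using f(2) by (auto simp: indicator_def fun_eq_iff)
      moreover have "compact B" "continuous_on B f"
        using f(1) by (auto simp: B_def intro: continuous_on_subset)
      ultimately show "integrable lborel f" "integral B f = (\<integral>x. f x \<partial>lborel)"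
        using integral_compact_lborel[of B f] by simp_all
    qed
    have i1: "integrable lborel (\<lambda>x. w (x + c *\<^sub>R axis i 1) $ i)" for i
      using supp by (intro int continuous_intros continuous_on_compose2[OF cont]) auto
    have i2: "integrable lborel (\<lambda>x. w x $ i)" for i
      using supp by (intro int continuous_intros cont) auto
    have "integral B (shift_divergence w k) = (\<integral>x. shift_divergence w k x \<partial>lborel)"
      using supp by (intro int continuous_shift_divergence[OF w(1)]) (auto simp: shift)
    also have "\<dots> = (\<Sum>i\<in>UNIV. ((\<integral>x. w (x + c *\<^sub>R axis i 1) $ i \<partial>lborel) - (\<integral>x. w x $ i \<partial>lborel)) / c)"
      unfolding shift using i1 i2 by (simp add: Bochner_Integration.integral_sum)
    also have "\<dots> = 0"
    proof -
      have "(\<integral>x. w (x + c *\<^sub>R axis i 1) $ i \<partial>lborel) = (\<integral>x. w x $ i \<partial>lborel)" for i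
        using integral_shift[of "\<lambda>x. w x $ i" "c *\<^sub>R axis i 1"]
        by (simp add: add.commute continuous_on_component cont)
      then show ?thesis by simp
    qed
    finally show ?thesis .
  qed
  moreover have "compact B" by (simp add: B_def)
  ultimately have "integral B (divergence w) = 0"
    using integral_mult_divergence_tendsto[OF w, of B "\<lambda>_. 1"] by (simp add: LIMSEQ_const_iff)
  moreover have "integral B (divergence w) = integral D (divergence w)"
  proof (rule integral_spike_set)
    show "negligible {x \<in> B - D. divergence w x \<noteq> 0}"
    proof -
      have "divergence w x = 0" if "x \<notin> D" for x
        using divergence_local(2)[of "- D" x w "\<lambda>_. 0"] that D compact_imp_closed[OF D(1)]
        by (auto simp: divergence_zero)
      then have "{x \<in> B - D. divergence w x \<noteq> 0} = {}" by blast
      then show ?thesis by (simp only: negligible_empty)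
    qed
    show "negligible {x \<in> D - B. divergence w x \<noteq> 0}"
      using DB by (auto intro: negligible_subset[OF negligible_empty])
  qed
  ultimately show ?thesis by simp
qed

section \<open>Point values of affine functions\<close>

lemma integral_dilation:
  fixes G :: "'a::euclidean_space \<Rightarrow> real"
  assumes "integrable lborel G" "c \<noteq> 0"
  shows integrable_dilation: "integrable lborel (\<lambda>x. G (t + c *\<^sub>R x))"
    and "(\<integral>x. G x \<partial>lborel) = \<bar>c\<bar> ^ DIM('a) * (\<integral>x. G (t + c *\<^sub>R x) \<partial>lborel)"
proof -
  have [measurable]: "G \<in> borel_measurable borel"
    using borel_measurable_integrable[OF assms(1)] by simp
  have c0: "\<bar>c\<bar> ^ DIM('a) > 0" using assms(2) by simp
  let ?M = "distr lborel borel (\<lambda>x. t + c *\<^sub>R x)"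
  have "ennreal (\<bar>c\<bar>) ^ DIM('a) = ennreal (\<bar>c\<bar> ^ DIM('a))"
    by (simp add: ennreal_power)
  then have l: "lborel = density ?M (\<lambda>_. ennreal (\<bar>c\<bar> ^ DIM('a)))"
    using lborel_affine[OF assms(2), of t] by simp
  have "integrable (density ?M (\<lambda>_. ennreal (\<bar>c\<bar> ^ DIM('a)))) G"
    using assms(1) l by simp
  then have "integrable ?M (\<lambda>x. \<bar>c\<bar> ^ DIM('a) *\<^sub>R G x)"
    by (subst (asm) integrable_density) auto
  then have "integrable lborel (\<lambda>x. \<bar>c\<bar> ^ DIM('a) *\<^sub>R G (t + c *\<^sub>R x))"
    by (subst (asm) integrable_distr_eq) auto
  then show "integrable lborel (\<lambda>x. G (t + c *\<^sub>R x))"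
    using c0 by simp
  have "(\<integral>x. G x \<partial>lborel) = (\<integral>x. G x \<partial>density ?M (\<lambda>_. ennreal (\<bar>c\<bar> ^ DIM('a))))"
    using l by simp
  also have "\<dots> = (\<integral>x. \<bar>c\<bar> ^ DIM('a) *\<^sub>R G x \<partial>?M)"
    by (rule integral_density) auto
  also have "\<dots> = (\<integral>x. \<bar>c\<bar> ^ DIM('a) *\<^sub>R G (t + c *\<^sub>R x) \<partial>lborel)"
    by (rule integral_distr) auto
  finally show "(\<integral>x. G x \<partial>lborel) = \<bar>c\<bar> ^ DIM('a) * (\<integral>x. G (t + c *\<^sub>R x) \<partial>lborel)"
    by simp
qed

lemma continuous_on_compact_integrable_on:
  fixes f :: "'a::euclidean_space \<Rightarrow> real"
  assumes "compact K" "continuous_on K f"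
  shows "f integrable_on K"
  using continuous_on_compact_integrable[OF assms] set_lebesgue_integral_eq_integral(1) by blast

lemma integral_const_compact:
  fixes c :: real
  assumes "compact (K :: 'a::euclidean_space set)"
  shows "integral K (\<lambda>_. c) = c * measure lebesgue K"
proof -
  have "integral K (\<lambda>_. c) = integral K (\<lambda>x. c * 1)" by simp
  also have "\<dots> = c * integral K (\<lambda>_. 1)" by (rule integral_mult_right)
  also have "integral K (\<lambda>_. 1) = measure lebesgue K"
    using lmeasure_integral[OF lmeasurable_compact[OF assms]] by simp
  finally show ?thesis .
qed

text \<open>
  The dilation with centre \<open>z\<close> and ratio \<open>1/2\<close> maps \<open>K\<close> into itself and \<open>f\<close> to \<open>(f z + f) / 2\<close>. As it
  scales areas by \<open>1/4\<close>, the integral \<open>J\<close> of \<open>(f z + f)\<^sup>2\<close> over \<open>K\<close> is at most \<open>16\<close> times the integral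
  \<open>I\<close> of \<open>f\<^sup>2\<close>, and \<open>f z = (f z + f) - f\<close> then gives the constant \<open>34 = 2 * 16 + 2\<close>. The
  constant is the same for every convex \<open>K\<close>, however long and thin.
\<close>

lemma affine_value_le_integral:
  fixes f :: "real^2 \<Rightarrow> real"
  assumes K: "compact K" "convex K" "z \<in> K" and f: "continuous_on K f"
    and mid: "\<And>x. x \<in> K \<Longrightarrow> f (midpoint z x) = (f z + f x) / 2"
  shows "measure lebesgue K * (f z)\<^sup>2 \<le> 34 * integral K (\<lambda>x. (f x)\<^sup>2)"
proof -
  let ?I = "integral K (\<lambda>x. (f x)\<^sup>2)" and ?J = "integral K (\<lambda>x. (f z + f x)\<^sup>2)"
  define G where "G = (\<lambda>x. indicator K x * (f x)\<^sup>2)"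
  note c = continuous_on_add[OF continuous_on_const[of K "f z"] f]
  have G: "integrable lborel G" "(\<integral>x. G x \<partial>lborel) = ?I"
    unfolding G_def using integral_compact_lborel[OF K(1), of "\<lambda>x. (f x)\<^sup>2"] f
    by (auto intro: continuous_intros)
  have J: "integrable lborel (\<lambda>x. indicator K x * (f z + f x)\<^sup>2)"
    "(\<integral>x. indicator K x * (f z + f x)\<^sup>2 \<partial>lborel) = ?J"
    using integral_compact_lborel[OF K(1) continuous_on_power[OF c]] by auto
  have "(1/4) * ?J = (\<integral>x. (1/4) * (indicator K x * (f z + f x)\<^sup>2) \<partial>lborel)"
    using J by simp
  also have "\<dots> \<le> (\<integral>x. G ((1/2) *\<^sub>R z + (1/2) *\<^sub>R x) \<partial>lborel)"
  proof (rule integral_mono)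
    show "integrable lborel (\<lambda>x. G ((1/2) *\<^sub>R z + (1/2) *\<^sub>R x))"
      by (rule integrable_dilation[OF G(1)]) simp
    show "integrable lborel (\<lambda>x. (1/4) * (indicator K x * (f z + f x)\<^sup>2))"
      using J by simp
    fix x
    have m: "(1/2) *\<^sub>R z + (1/2) *\<^sub>R x = midpoint z x"
      by (simp add: midpoint_def scaleR_add_right)
    show "(1/4) * (indicator K x * (f z + f x)\<^sup>2) \<le> G ((1/2) *\<^sub>R z + (1/2) *\<^sub>R x)"
    proof (cases "x \<in> K")
      case True
      then have "midpoint z x \<in> K"
        using K by (metis convex_contains_segment midpoint_in_closed_segment subset_iff)
      moreover have "(1/4) * (f z + f x)\<^sup>2 = (f (midpoint z x))\<^sup>2"
        unfolding mid[OF True] by (simp add: power_divide)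
      ultimately show ?thesis using True by (simp add: G_def m)
    qed (simp add: G_def)
  qed
  also have "\<dots> = 4 * ?I"
    using integral_dilation(2)[OF G(1), of "1/2" "(1/2) *\<^sub>R z"] G(2) by (simp add: power2_eq_square)
  finally have JI: "?J \<le> 16 * ?I" by simp
  have "measure lebesgue K * (f z)\<^sup>2 = integral K (\<lambda>x. (f z)\<^sup>2)"
    using integral_const_compact[OF K(1)] by simp
  also have "\<dots> \<le> integral K (\<lambda>x. 2 * (f z + f x)\<^sup>2 + 2 * (f x)\<^sup>2)"
  proof (rule integral_le)
    fix x show "(f z)\<^sup>2 \<le> 2 * (f z + f x)\<^sup>2 + 2 * (f x)\<^sup>2"
      using zero_le_power2[of "f z + 2 * f x"] by (simp add: power2_eq_square algebra_simps)
  qed (intro continuous_on_compact_integrable_on[OF K(1)] continuous_intros f)+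
  also have "\<dots> = 2 * ?J + 2 * ?I"
    by (subst integral_add) (auto intro!: continuous_on_compact_integrable_on[OF K(1)] continuous_intros f)
  finally show ?thesis using JI by simp
qed

lemma poly_on_1_midpoint:
  assumes "f \<in> poly_on 1 K" "convex K" "z \<in> K" "x \<in> K"
  shows "f (midpoint z x) = (f z + f x) / 2"
proof -
  obtain c where c: "\<forall>x\<in>K. f x = (\<Sum>i\<le>1. \<Sum>j\<le>1 - i. c i j * (x$1)^i * (x$2)^j)"
    using assms(1) unfolding poly_on_def by blast
  have "midpoint z x \<in> K"
    using assms by (metis convex_contains_segment midpoint_in_closed_segment subset_iff)
  then show ?thesis using assms c by (simp add: midpoint_def field_simps)
qed

section \<open>Extension of velocities by zero\<close>

text \<open>
  What the argument uses of a triangulated region: finitely many convex pieces of positive area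
  that fill it.
\<close>

definition mesh :: "(real^2) set set \<Rightarrow> (real^2) set \<Rightarrow> bool" where
  "mesh P D \<longleftrightarrow> finite {K\<in>P. K \<subseteq> D} \<and> (\<forall>x\<in>D. \<exists>K\<in>P. K \<subseteq> D \<and> x \<in> K) \<and>
     (\<forall>K\<in>P. K \<subseteq> D \<longrightarrow> compact K \<and> convex K \<and> measure lebesgue K > 0)"

lemma mesh_cover: "mesh P D \<Longrightarrow> \<Union>{K\<in>P. K \<subseteq> D} = D"
  unfolding mesh_def by blast

lemma mesh_compact:
  assumes "mesh P D"
  shows "compact D"
proof -
  have "compact (\<Union>{K\<in>P. K \<subseteq> D})"
    using assms by (intro compact_Union) (auto simp: mesh_def)
  then show ?thesis by (simp only: mesh_cover[OF assms])
qed

lemma mesh_frontier_negligible: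
  assumes "mesh P D"
  shows "negligible (\<Union>K\<in>{K\<in>P. K \<subseteq> D}. frontier K)"
  using assms by (intro negligible_Union) (auto simp: mesh_def negligible_convex_frontier)

lemma mesh_frontier_subset:
  assumes "mesh P D"
  shows "frontier D \<subseteq> (\<Union>K\<in>{K\<in>P. K \<subseteq> D}. frontier K)"
proof
  fix x assume x: "x \<in> frontier D"
  then have "x \<in> D" using compact_imp_closed[OF mesh_compact[OF assms]] by (auto simp: frontier_def)
  then obtain K where K: "K \<in> P" "K \<subseteq> D" "x \<in> K" using assms by (auto simp: mesh_def)
  then have "x \<notin> interior K" using x interior_mono[OF K(2)] by (auto simp: frontier_def)
  then have "x \<in> frontier K" using K closure_subset by (auto simp: frontier_def)
  then show "x \<in> (\<Union>K\<in>{K\<in>P. K \<subseteq> D}. frontier K)" using K by blast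
qed

definition zero_ext :: "(real^2) set \<Rightarrow> (real^2 \<Rightarrow> real^2) \<Rightarrow> real^2 \<Rightarrow> real^2" where
  "zero_ext D v x = (if x \<in> D then v x else 0)"

text \<open>
  The extension is Lipschitz on each triangle of \<open>D\<close>, being polynomial there, and vanishes on the
  closure of the complement of \<open>D\<close>, which includes the boundary; these closed sets cover the plane.
\<close>

lemma zero_ext_lipschitz:
  assumes D: "mesh P D" and v: "v \<in> velocity_space P D"
  shows "\<exists>L. L-lipschitz_on UNIV (zero_ext D v)"
proof (rule lipschitz_on_closed_cover[where \<U> = "insert (closure (- D)) {K\<in>P. K \<subseteq> D}"])
  show "finite (insert (closure (- D)) {K\<in>P. K \<subseteq> D})" using D by (simp add: mesh_def)
  show "\<Union>(insert (closure (- D)) {K\<in>P. K \<subseteq> D}) = UNIV"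
    using mesh_cover[OF D] closure_subset[of "- D"] by blast
next
  fix U assume "U \<in> insert (closure (- D)) {K\<in>P. K \<subseteq> D}"
  then show "closed U" using D by (auto simp: mesh_def compact_imp_closed)
next
  fix U assume "U \<in> insert (closure (- D)) {K\<in>P. K \<subseteq> D}"
  then consider "U = closure (- D)" | "U \<in> P" "U \<subseteq> D" by blast
  then show "\<exists>L. L-lipschitz_on U (zero_ext D v)"
  proof cases
    case 1
    have "zero_ext D v x = 0" if "x \<in> U" for x
    proof (cases "x \<in> D")
      case True
      then have "x \<in> frontier D" using that 1 closure_subset[of D] by (auto simp: frontier_closures)
      then show ?thesis using v by (auto simp: velocity_space_def zero_ext_def)
    qed (simp add: zero_ext_def)
    then have "0-lipschitz_on U (zero_ext D v)" by (auto simp: lipschitz_on_def)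
    then show ?thesis ..
  next
    case 2
    then have cK: "compact U" using D by (auto simp: mesh_def)
    have "\<exists>L. L-lipschitz_on U (\<lambda>x. v x $ i)" for i
    proof -
      have "(\<lambda>x. v x $ i) \<in> poly_on 2 U" using v 2 by (auto simp: velocity_space_def)
      from poly_on_real_polynomial[OF this]
      obtain g where g: "real_polynomial_function g \<and> (\<forall>x\<in>U. v x $ i = g x)" ..
      then show ?thesis using real_polynomial_lipschitz[OF conjunct1[OF g] cK] g by (auto simp: lipschitz_on_def)
    qed
    then obtain L where L: "\<And>i. (L i)-lipschitz_on U (\<lambda>x. v x $ i)" by metis
    have "(\<Sum>i\<in>UNIV. L i)-lipschitz_on U (zero_ext D v)"
    proof (rule lipschitz_onI)
      fix x y assume xy: "x \<in> U" "y \<in> U"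
      then have "dist (zero_ext D v x) (zero_ext D v y) = norm (v x - v y)"
        using 2 by (auto simp: zero_ext_def dist_norm)
      also have "\<dots> \<le> (\<Sum>i\<in>UNIV. \<bar>(v x - v y) $ i\<bar>)" by (rule norm_le_l1_cart)
      also have "\<dots> \<le> (\<Sum>i\<in>UNIV. L i * dist x y)"
        using lipschitz_onD[OF L xy] by (intro sum_mono) (auto simp: dist_real_def)
      finally show "dist (zero_ext D v x) (zero_ext D v y) \<le> (\<Sum>i\<in>UNIV. L i) * dist x y"
        by (simp add: sum_distrib_right)
    next
      show "0 \<le> (\<Sum>i\<in>UNIV. L i)" using lipschitz_on_nonneg[OF L] by (intro sum_nonneg) auto
    qed
    then show ?thesis ..
  qed
qed

lemma zero_ext_differentiable:
  assumes D: "mesh P D" and v: "v \<in> velocity_space P D"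
    and x: "x \<notin> (\<Union>K\<in>{K\<in>P. K \<subseteq> D}. frontier K)"
  shows "zero_ext D v differentiable (at x)"
proof (cases "x \<in> D")
  case True
  then obtain K where K: "K \<in> P" "K \<subseteq> D" "x \<in> K" using D by (auto simp: mesh_def)
  then have xK: "x \<in> interior K" using x closure_subset[of K] by (auto simp: frontier_def)
  have "\<exists>g. \<forall>i. real_polynomial_function (g i) \<and> (\<forall>x\<in>K. v x $ i = g i x)"
  proof (rule choice, rule allI)
    fix i
    have "(\<lambda>x. v x $ i) \<in> poly_on 2 K" using v K by (auto simp: velocity_space_def)
    then show "\<exists>g. real_polynomial_function g \<and> (\<forall>x\<in>K. v x $ i = g x)"
      by (rule poly_on_real_polynomial)
  qed
  then obtain g where g: "\<And>i. real_polynomial_function (g i)" "\<And>i x. x \<in> K \<Longrightarrow> v x $ i = g i x"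
    by blast
  have "(\<lambda>x. \<chi> i. g i x) differentiable (at x)" (is "?g differentiable _")
    using g(1) by (intro differentiable_at_polynomial_function)
      (auto simp: polynomial_function_iff_Basis_inner Basis_vec_def inner_axis)
  then obtain f where f: "(?g has_derivative f) (at x)"
    unfolding differentiable_def by blast
  have "?g y = zero_ext D v y" if "y \<in> interior K" for y
  proof -
    have y: "y \<in> K" using that interior_subset[of K] by (rule subsetD[rotated])
    have "y \<in> D" using y K(2) by (rule subsetD[rotated])
    then have "zero_ext D v y $ i = g i y" for i using g(2)[OF y] by (simp only: zero_ext_def if_True)
    then show ?thesis by (simp only: vec_eq_iff vec_lambda_beta simp_thms)
  qed
  then have "(zero_ext D v has_derivative f) (at x)"
    by (rule has_derivative_transform_within_open[OF f open_interior xK])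
  then show ?thesis unfolding differentiable_def by blast
next
  case False
  have "open (- D)" using compact_imp_closed[OF mesh_compact[OF D]] by (rule open_Compl)
  from has_derivative_transform_within_open[OF has_derivative_const[of 0] this, of x "zero_ext D v"]
  have "(zero_ext D v has_derivative (\<lambda>_. 0)) (at x)"
    using False by (simp add: zero_ext_def)
  then show ?thesis unfolding differentiable_def by blast
qed

text \<open>
  On a triangle outside \<open>D\<close> the extension has to vanish also at the points of \<open>D\<close>. These lie on the
  boundary of \<open>D\<close>: a triangle is the closure of its interior, so if it met the interior of \<open>D\<close>,
  the overlap would contain a nonempty open set.
\<close>

lemma zero_ext_velocity:
  assumes D: "mesh P D" and W: "mesh P W" and DW: "D \<subseteq> W"
    and sep: "\<And>K. K \<in> P \<Longrightarrow> K \<subseteq> W \<Longrightarrow> K \<subseteq> D \<or> negligible (K \<inter> D)"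
    and v: "v \<in> velocity_space P D"
  shows "zero_ext D v \<in> velocity_space P W"
proof -
  have outside: "zero_ext D v x = 0" if "x \<notin> interior D" for x
    using that v closure_subset[of D] by (auto simp: zero_ext_def velocity_space_def frontier_def)
  have "(\<lambda>x. zero_ext D v x $ i) \<in> poly_on 2 K" if K: "K \<in> P" "K \<subseteq> W" for K i
  proof (cases "K \<subseteq> D")
    case True
    then have "(\<lambda>x. v x $ i) \<in> poly_on 2 K" using v K by (auto simp: velocity_space_def)
    moreover have "zero_ext D v x $ i = v x $ i" if "x \<in> K" for x
      using that True by (auto simp: zero_ext_def)
    ultimately show ?thesis unfolding poly_on_def by auto
  next
    case False
    then have neg: "negligible (K \<inter> D)" using sep K by blast
    have Kc: "convex K" "measure lebesgue K > 0" using W K by (auto simp: mesh_def)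
    then have "interior K \<noteq> {}"
      using negligible_convex_interior[of K] by (auto simp: negligible_iff_measure)
    then have cl: "closure (interior K) = closure K" by (rule convex_closure_interior[OF Kc(1)])
    have "zero_ext D v x = 0" if x: "x \<in> K" for x
    proof (rule outside, rule notI)
      assume "x \<in> interior D"
      moreover have "x \<in> closure (interior K)" using x cl closure_subset by blast
      ultimately have "interior D \<inter> interior K \<noteq> {}"
        using open_Int_closure_eq_empty[OF open_interior, of D "interior K"] by blast
      then have "\<not> negligible (interior D \<inter> interior K)"
        by (intro open_not_negligible) auto
      moreover have "interior D \<inter> interior K \<subseteq> K \<inter> D" using interior_subset by blast
      ultimately show False using neg negligible_subset by blast
    qed
    then show ?thesis unfolding poly_on_def by (auto intro!: exI[of _ "\<lambda>_ _. 0"])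
  qed
  moreover have "continuous_on W (zero_ext D v)"
    using zero_ext_lipschitz[OF D v] by (meson continuous_on_subset lipschitz_on_continuous_on subset_UNIV)
  moreover have "zero_ext D v x = 0" if "x \<in> frontier W" for x
    using that interior_mono[OF DW] by (intro outside) (auto simp: frontier_def)
  ultimately show ?thesis by (auto simp: velocity_space_def)
qed

lemma integral_eq_on_interior:
  fixes F G :: "real^2 \<Rightarrow> real"
  assumes "mesh P D" "D \<subseteq> W" "\<And>x. x \<in> interior D \<Longrightarrow> F x = G x" "\<And>x. x \<notin> D \<Longrightarrow> F x = 0"
  shows "integral W F = integral D G"
proof -
  have "{x \<in> W - D. F x \<noteq> 0} = {}" "{x \<in> D - W. F x \<noteq> 0} = {}" using assms by auto
  then have "integral W F = integral D F"
    by (intro integral_spike_set) (simp_all only: negligible_empty)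
  also have "negligible (frontier D)"
    using negligible_subset[OF mesh_frontier_negligible mesh_frontier_subset] assms(1) by blast
  then have "integral D F = integral D G"
    by (rule integral_spike) (use assms(3) closure_subset[of D] in \<open>auto simp: frontier_def\<close>)
  finally show ?thesis .
qed

lemma jacobian_zero_ext:
  shows "x \<in> interior D \<Longrightarrow> jacobian (zero_ext D v) (at x) = jacobian v (at x)"
    and "closed D \<Longrightarrow> x \<notin> D \<Longrightarrow> jacobian (zero_ext D v) (at x) = 0"
proof -
  show "jacobian (zero_ext D v) (at x) = jacobian v (at x)" if "x \<in> interior D"
    using that interior_subset by (intro jacobian_local[of "interior D"]) (auto simp: zero_ext_def)
  show "jacobian (zero_ext D v) (at x) = 0" if "closed D" "x \<notin> D"
    using that jacobian_local[of "- D" x "zero_ext D v" "\<lambda>_. 0"]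
    by (auto simp: zero_ext_def jacobian_zero)
qed

lemma H1_seminorm_zero_ext:
  assumes "mesh P D" "D \<subseteq> W"
  shows "H1_seminorm_on W (zero_ext D v) = H1_seminorm_on D v"
proof -
  have "closed D" using mesh_compact[OF assms(1)] by (rule compact_imp_closed)
  then show ?thesis
    unfolding H1_seminorm_on_def L2_norm_on_def
    using assms by (subst integral_eq_on_interior[OF assms]) (auto simp: jacobian_zero_ext)
qed

text \<open>
  The constant \<open>a\<close> may be subtracted because the extension has compact support, hence a divergence
  of integral zero. Consequently, testing \<open>q\<close> with velocities of \<open>D\<close> amounts to testing its
  deviation from the mean over \<open>D\<close>.
\<close>

lemma integral_div_zero_ext:
  assumes D: "mesh P D" "D \<subseteq> W" and v: "v \<in> velocity_space P D" and q: "continuous_on D q"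
  shows "integral W (\<lambda>x. q x * divergence (zero_ext D v) x) = integral D (\<lambda>x. (q x - a) * divergence v x)"
proof -
  let ?w = "zero_ext D v"
  have cD: "compact D" "closed D" using mesh_compact[OF D(1)] by (auto intro: compact_imp_closed)
  obtain L where L: "L-lipschitz_on UNIV ?w" using zero_ext_lipschitz[OF D(1) v] by blast
  note w = L mesh_frontier_negligible[OF D(1)] zero_ext_differentiable[OF D(1) v]
  have w0: "divergence ?w x = 0" if "x \<notin> D" for x
    using that cD by (simp add: divergence_def jacobian_zero_ext trace_def)
  have i: "(\<lambda>x. q x * divergence ?w x) integrable_on D" "(\<lambda>x. a * divergence ?w x) integrable_on D"
    using cD q by (auto intro!: integrable_mult_divergence[OF w])
  have "integral W (\<lambda>x. q x * divergence ?w x) = integral D (\<lambda>x. q x * divergence ?w x)"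
    using w0 by (intro integral_eq_on_interior[OF D]) auto
  also have "\<dots> = integral D (\<lambda>x. q x * divergence ?w x) - a * integral D (divergence ?w)"
    using integral_divergence_eq_0[OF w cD(1)] by (simp add: zero_ext_def)
  also have "\<dots> = integral D (\<lambda>x. (q x - a) * divergence ?w x)"
    using integral_diff[OF i] by (simp add: left_diff_distrib integral_mult_right)
  also have "\<dots> = integral W (\<lambda>x. (q x - a) * divergence ?w x)"
    using w0 by (intro integral_eq_on_interior[OF D, symmetric]) auto
  also have "\<dots> = integral D (\<lambda>x. (q x - a) * divergence v x)"
    using w0 by (intro integral_eq_on_interior[OF D]) (auto simp: divergence_def jacobian_zero_ext)
  finally show ?thesis .
qed

section \<open>Inf-sup stability of a union of two stable regions\<close>

definition mean_value :: "'a::euclidean_space set \<Rightarrow> ('a \<Rightarrow> real) \<Rightarrow> real" where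
  "mean_value D q = integral D q / measure lebesgue D"

lemma pressure_minus_mean:
  assumes D: "compact D" "measure lebesgue D > 0" and q: "continuous_on D q"
  shows integral_minus_mean: "integral D (\<lambda>x. q x - mean_value D q) = 0"
    and integral_square_mean: "integral D (\<lambda>x. (q x)\<^sup>2) =
      integral D (\<lambda>x. (q x - mean_value D q)\<^sup>2) + (mean_value D q)\<^sup>2 * measure lebesgue D"
proof -
  let ?a = "mean_value D q"
  note int = continuous_on_compact_integrable_on[OF D(1)]
  show 0: "integral D (\<lambda>x. q x - ?a) = 0"
    using D by (subst integral_diff)
      (auto intro!: int continuous_intros q simp: integral_const_compact mean_value_def)
  have "integral D (\<lambda>x. (q x)\<^sup>2) = integral D (\<lambda>x. (q x - ?a)\<^sup>2 + (2 * ?a * (q x - ?a) + ?a\<^sup>2))"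
    by (rule arg_cong[where f="integral D"]) (simp add: fun_eq_iff power2_eq_square algebra_simps)
  also have "\<dots> = integral D (\<lambda>x. (q x - ?a)\<^sup>2) + integral D (\<lambda>x. 2 * ?a * (q x - ?a) + ?a\<^sup>2)"
    by (intro integral_add int continuous_intros q)
  also have "integral D (\<lambda>x. 2 * ?a * (q x - ?a) + ?a\<^sup>2) =
      integral D (\<lambda>x. 2 * ?a * (q x - ?a)) + integral D (\<lambda>x. ?a\<^sup>2)"
    by (intro integral_add int continuous_intros q)
  also have "integral D (\<lambda>x. 2 * ?a * (q x - ?a)) = 0"
    using 0 by (simp only: integral_mult_right mult_zero_right)
  also have "integral D (\<lambda>x. ?a\<^sup>2) = ?a\<^sup>2 * measure lebesgue D"
    by (rule integral_const_compact[OF D(1)])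
  finally show "integral D (\<lambda>x. (q x)\<^sup>2) = integral D (\<lambda>x. (q x - ?a)\<^sup>2) + ?a\<^sup>2 * measure lebesgue D"
    by simp
qed

lemma poly_on_1_diff_const:
  assumes "q \<in> poly_on 1 K"
  shows "(\<lambda>x. q x - a) \<in> poly_on 1 K"
proof -
  obtain c where c: "\<forall>x\<in>K. q x = (\<Sum>i\<le>1. \<Sum>j\<le>1 - i. c i j * (x$1)^i * (x$2)^j)"
    using assms unfolding poly_on_def by blast
  then show ?thesis unfolding poly_on_def
    by (intro CollectI exI[of _ "\<lambda>i j. if i = 0 \<and> j = 0 then c 0 0 - a else c i j"]) simp
qed

lemma pressure_value_le:
  assumes W: "mesh P D" and q: "continuous_on D q" "\<And>K. K \<in> P \<Longrightarrow> K \<subseteq> D \<Longrightarrow> q \<in> poly_on 1 K"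
    and K: "K \<in> P" "K \<subseteq> D" "z \<in> K"
  shows "measure lebesgue K * (q z - a)\<^sup>2 \<le> 34 * integral D (\<lambda>x. (q x - a)\<^sup>2)"
proof -
  have cK: "compact K" "convex K" using W K by (auto simp: mesh_def)
  have qK: "continuous_on K (\<lambda>x. q x - a)"
    using q K by (auto intro!: continuous_intros intro: continuous_on_subset)
  have "measure lebesgue K * (q z - a)\<^sup>2 \<le> 34 * integral K (\<lambda>x. (q x - a)\<^sup>2)"
    using poly_on_1_midpoint[OF poly_on_1_diff_const[OF q(2)[OF K(1,2)], of a] cK(2) K(3)]
    by (intro affine_value_le_integral[OF cK K(3) qK]) auto
  also have "integral K (\<lambda>x. (q x - a)\<^sup>2) \<le> integral D (\<lambda>x. (q x - a)\<^sup>2)"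
    using K q by (intro integral_subset_le continuous_on_compact_integrable_on cK mesh_compact[OF W])
      (auto intro!: continuous_intros intro: continuous_on_subset)
  finally show ?thesis by simp
qed

lemma mesh_Un:
  assumes "finite P" "mesh P D" "mesh P E" "\<And>K. K \<in> P \<Longrightarrow> K \<subseteq> D \<or> K \<subseteq> E"
  shows "mesh P (D \<union> E)"
  unfolding mesh_def
proof (intro conjI ballI impI)
  show "finite {K \<in> P. K \<subseteq> D \<union> E}" using assms(1) by simp
next
  fix x assume "x \<in> D \<union> E"
  then show "\<exists>K\<in>P. K \<subseteq> D \<union> E \<and> x \<in> K"
    using assms(2,3) unfolding mesh_def by (meson Un_iff le_supI1 le_supI2)
next
  fix K assume "K \<in> P"
  then have "compact K \<and> convex K \<and> measure lebesgue K > 0"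
    using assms(2-4) unfolding mesh_def by metis
  then show "compact K" "convex K" "measure lebesgue K > 0" by auto
qed

text \<open>
  Continuity enters here: both \<open>q - a\<close> and \<open>q - b\<close> are evaluated at the common point \<open>z\<close>, where
  \<open>a\<close> and \<open>b\<close> are the two mean values. This gives
  \<open>\<bar>D\<bar> (a - b)\<^sup>2 \<le> 2 * 32 * 34 * (X + Y)\<close> for the squared deviations \<open>X\<close> and \<open>Y\<close>; adding
  these yields the constant \<open>2177 = 2176 + 1\<close>.
\<close>

lemma square_norm_le_deviations:
  assumes D: "mesh P D" and E: "mesh P E" and neg: "negligible (D \<inter> E)"
    and q: "continuous_on (D \<union> E) q" "\<And>K. K \<in> P \<Longrightarrow> K \<subseteq> D \<union> E \<Longrightarrow> q \<in> poly_on 1 K"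
      "integral (D \<union> E) q = 0"
    and K: "K \<in> P" "K \<subseteq> D" "z \<in> K" and K': "K' \<in> P" "K' \<subseteq> E" "z \<in> K'"
    and m: "measure lebesgue D \<le> 32 * measure lebesgue K" "measure lebesgue D \<le> 32 * measure lebesgue K'"
    and pos: "measure lebesgue D > 0" "measure lebesgue E > 0"
  shows "integral (D \<union> E) (\<lambda>x. (q x)\<^sup>2) \<le>
    2177 * (integral D (\<lambda>x. (q x - mean_value D q)\<^sup>2) + integral E (\<lambda>x. (q x - mean_value E q)\<^sup>2))"
proof -
  let ?A = "measure lebesgue D" and ?B = "measure lebesgue E"
  let ?a = "mean_value D q" and ?b = "mean_value E q"
  let ?X = "integral D (\<lambda>x. (q x - ?a)\<^sup>2)" and ?Y = "integral E (\<lambda>x. (q x - ?b)\<^sup>2)"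
  note cD = mesh_compact[OF D] and cE = mesh_compact[OF E]
  have qD: "continuous_on D q" and qE: "continuous_on E q" using q(1) by (auto intro: continuous_on_subset)
  have "integral (D \<union> E) q = integral D q + integral E q"
    using neg by (intro integral_Un continuous_on_compact_integrable_on cD cE qD qE)
  then have ab: "?a * ?A = - (?b * ?B)"
    using q(3) pos by (simp add: mean_value_def)
  have "measure lebesgue K * (q z - ?a)\<^sup>2 \<le> 34 * ?X"
    using q(2) by (intro pressure_value_le[OF D qD _ K]) auto
  moreover have "?A * (q z - ?a)\<^sup>2 \<le> 32 * measure lebesgue K * (q z - ?a)\<^sup>2"
    using m(1) by (intro mult_right_mono) auto
  moreover have "measure lebesgue K' * (q z - ?b)\<^sup>2 \<le> 34 * ?Y"
    using q(2) by (intro pressure_value_le[OF E qE _ K']) auto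
  moreover have "?A * (q z - ?b)\<^sup>2 \<le> 32 * measure lebesgue K' * (q z - ?b)\<^sup>2"
    using m(2) by (intro mult_right_mono) auto
  moreover have "?A * (?a - ?b)\<^sup>2 \<le> ?A * (2 * (q z - ?a)\<^sup>2 + 2 * (q z - ?b)\<^sup>2)"
  proof (rule mult_left_mono)
    show "(?a - ?b)\<^sup>2 \<le> 2 * (q z - ?a)\<^sup>2 + 2 * (q z - ?b)\<^sup>2"
      using zero_le_power2[of "2 * q z - ?a - ?b"] by (simp add: power2_eq_square algebra_simps)
  qed simp
  ultimately have jump: "?A * (?a - ?b)\<^sup>2 \<le> 2176 * (?X + ?Y)"
    by (simp add: distrib_left)
  \<comment> \<open>As the total mean vanishes, the piecewise constant part has squared norm at most \<open>?A * (?a - ?b)\<^sup>2\<close>.\<close>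
  have "?A * (?a - ?b)\<^sup>2 - (?a\<^sup>2 * ?A + ?b\<^sup>2 * ?B) = ?b\<^sup>2 * ?A - 2 * ?b * (?a * ?A) - ?b\<^sup>2 * ?B"
    by (simp add: power2_eq_square algebra_simps)
  also have "\<dots> = ?b\<^sup>2 * (?A + ?B)"
    unfolding ab by (simp add: power2_eq_square algebra_simps)
  finally have "?a\<^sup>2 * ?A + ?b\<^sup>2 * ?B \<le> ?A * (?a - ?b)\<^sup>2"
    using pos by (smt (verit) mult_nonneg_nonneg zero_le_power2)
  moreover have "integral (D \<union> E) (\<lambda>x. (q x)\<^sup>2) = integral D (\<lambda>x. (q x)\<^sup>2) + integral E (\<lambda>x. (q x)\<^sup>2)"
    using neg by (intro integral_Un continuous_on_compact_integrable_on cD cE continuous_intros qD qE)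
  ultimately show ?thesis
    using integral_square_mean[OF cD pos(1) qD] integral_square_mean[OF cE pos(2) qE] jump by simp
qed

text \<open>
  Half of the stability constant is given away: since the supremum over the velocities of \<open>D\<close> is
  at least \<open>b\<close>, some velocity has a quotient above \<open>b / 2\<close>. Its quotient for \<open>q\<close> on \<open>W\<close> differs only
  by the ratio of the two pressure norms. A positive quotient also rules out the convention
  \<open>x / 0 = 0\<close>, so a vanishing seminorm needs no separate treatment.
\<close>

lemma SUP_quotient_ge_of_part:
  assumes D: "mesh P D" and W: "mesh P W" and DW: "D \<subseteq> W"
    and sep: "\<And>K. K \<in> P \<Longrightarrow> K \<subseteq> W \<Longrightarrow> K \<subseteq> D \<or> negligible (K \<inter> D)"
    and pos: "measure lebesgue D > 0" and b: "b > 0" "inf_sup_stable P D b"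
    and q: "q \<in> pressure_space P W"
    and C: "0 < C" "0 < L2_norm_on W q" "L2_norm_on W q \<le> C * L2_norm_on D (\<lambda>x. q x - mean_value D q)"
  shows "ereal (b / (2 * C)) \<le> (SUP v \<in> {v \<in> velocity_space P W. nonzero_on W v}.
    ereal (integral W (\<lambda>x. q x * divergence v x) / (H1_seminorm_on W v * L2_norm_on W q)))"
proof -
  define p where "p = (\<lambda>x. q x - mean_value D q)"
  define N where "N = L2_norm_on D p"
  have qD: "continuous_on D q" using q DW by (auto simp: pressure_space_def intro: continuous_on_subset)
  have "q \<in> poly_on 1 K" if "K \<in> P" "K \<subseteq> D" for K
    using q that DW unfolding pressure_space_def by blast
  then have p: "p \<in> pressure_space P D"
    using integral_minus_mean[OF mesh_compact[OF D] pos qD]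
    unfolding pressure_space_def p_def mem_Collect_eq
    by (intro conjI ballI impI continuous_on_diff qD continuous_on_const poly_on_1_diff_const)
  have "0 < C * N" using C by (simp add: N_def p_def)
  then have N: "0 < N" using C by (simp add: zero_less_mult_iff)
  have "nonzero_on D p"
  proof (rule ccontr)
    assume "\<not> nonzero_on D p"
    then have "integral D (\<lambda>x. (norm (p x))\<^sup>2) = integral D (\<lambda>x. 0)"
      by (intro integral_cong) (auto simp: nonzero_on_def)
    then show False using N by (simp add: N_def L2_norm_on_def)
  qed
  then have "inf_sup P D \<le> (SUP v \<in> {v \<in> velocity_space P D. nonzero_on D v}.
      ereal (integral D (\<lambda>x. p x * divergence v x) / (H1_seminorm_on D v * N)))"
    unfolding inf_sup_def N_def using p by (intro INF_lower) auto
  moreover have "ereal (b / 2) < inf_sup P D"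
    using b unfolding inf_sup_stable_def by (elim less_le_trans[rotated]) simp
  ultimately have "ereal (b / 2) < (SUP v \<in> {v \<in> velocity_space P D. nonzero_on D v}.
      ereal (integral D (\<lambda>x. p x * divergence v x) / (H1_seminorm_on D v * N)))"
    by (rule less_le_trans[rotated])
  then obtain v where v: "v \<in> velocity_space P D" "nonzero_on D v"
    and ratio: "b / 2 < integral D (\<lambda>x. p x * divergence v x) / (H1_seminorm_on D v * N)"
    unfolding less_SUP_iff by auto
  let ?w = "zero_ext D v"
  have "nonzero_on W ?w" using v(2) DW by (auto simp: nonzero_on_def zero_ext_def)
  moreover have "?w \<in> velocity_space P W" by (rule zero_ext_velocity[OF D W DW sep v(1)])
  moreover have "b / (2 * C) \<le> integral W (\<lambda>x. q x * divergence ?w x) / (H1_seminorm_on W ?w * L2_norm_on W q)"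
  proof -
    let ?I = "integral D (\<lambda>x. p x * divergence v x)" and ?H = "H1_seminorm_on D v"
    have le: "1 / C \<le> N / L2_norm_on W q"
      using C by (simp add: N_def p_def field_simps)
    have "0 \<le> ?I / (?H * N)" using ratio b by linarith
    then have "(b / 2) * (1 / C) \<le> (?I / (?H * N)) * (N / L2_norm_on W q)"
      using C by (intro mult_mono[OF less_imp_le[OF ratio] le]) simp_all
    also have "\<dots> = ?I / (?H * L2_norm_on W q)" using N by simp
    finally show ?thesis
      by (simp add: integral_div_zero_ext[OF D DW v(1) qD, of "mean_value D q"]
          H1_seminorm_zero_ext[OF D DW] p_def)
  qed
  ultimately show ?thesis by (intro SUP_upper2[of ?w]) auto
qed

text \<open>
  A single velocity suffices: it is taken from the part on which \<open>q\<close> deviates more from its mean.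
  The squared norm of \<open>q\<close> is at most \<open>2 * 2177\<close> times the larger squared deviation, and
  \<open>2 * 2177 \<le> 100\<^sup>2\<close>.
\<close>

lemma inf_sup_union:
  assumes D: "mesh P D" and E: "mesh P E" and P: "finite P" "\<And>K. K \<in> P \<Longrightarrow> K \<subseteq> D \<or> K \<subseteq> E"
    and neg: "negligible (D \<inter> E)"
    and K: "K \<in> P" "K \<subseteq> D" "z \<in> K" and K': "K' \<in> P" "K' \<subseteq> E" "z \<in> K'"
    and m: "measure lebesgue D \<le> 32 * measure lebesgue K" "measure lebesgue D \<le> 32 * measure lebesgue K'"
    and b: "b > 0" "inf_sup_stable P D b" and b': "b' > 0" "inf_sup_stable P E b'"
  shows "ereal (min b b' / 200) \<le> inf_sup P (D \<union> E)"
  unfolding inf_sup_def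
proof (rule INF_greatest)
  let ?W = "D \<union> E"
  fix q assume "q \<in> {q \<in> pressure_space P ?W. nonzero_on ?W q}"
  then have q: "q \<in> pressure_space P ?W" and nz: "nonzero_on ?W q" by auto
  have W: "mesh P ?W" using mesh_Un[OF P(1) D E P(2)] by blast
  have pos: "measure lebesgue D > 0" "measure lebesgue E > 0"
  proof -
    have "measure lebesgue K \<le> measure lebesgue D"  "measure lebesgue K' \<le> measure lebesgue E"
      using K K' D E mesh_compact[OF D] mesh_compact[OF E]
      by (auto intro!: measure_mono_fmeasurable simp: mesh_def lmeasurable_compact intro: fmeasurableD)
    then show "measure lebesgue D > 0" "measure lebesgue E > 0"
      using K K' D E by (auto simp: mesh_def intro: less_le_trans)
  qed
  define X where "X = L2_norm_on D (\<lambda>x. q x - mean_value D q)"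
  define Y where "Y = L2_norm_on E (\<lambda>x. q x - mean_value E q)"
  define Z where "Z = L2_norm_on ?W q"
  have qc: "continuous_on ?W q" "integral ?W q = 0" "\<And>K. K \<in> P \<Longrightarrow> K \<subseteq> ?W \<Longrightarrow> q \<in> poly_on 1 K"
    using q by (auto simp: pressure_space_def)
  have int: "0 \<le> integral S (\<lambda>x. (f x)\<^sup>2)" for S :: "(real^2) set" and f :: "real^2 \<Rightarrow> real"
    by (cases "(\<lambda>x. (f x)\<^sup>2) integrable_on S") (auto simp: integral_nonneg not_integrable_integral)
  then have sq: "(L2_norm_on S f)\<^sup>2 = integral S (\<lambda>x. (f x)\<^sup>2)"
    for S :: "(real^2) set" and f :: "real^2 \<Rightarrow> real"
    by (simp add: L2_norm_on_def)
  have nonneg: "0 \<le> X" "0 \<le> Y" "0 \<le> Z"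
    using int by (simp_all add: X_def Y_def Z_def L2_norm_on_def)
  have Z_le: "Z\<^sup>2 \<le> 2177 * (X\<^sup>2 + Y\<^sup>2)"
    unfolding X_def Y_def Z_def sq
    by (rule square_norm_le_deviations[OF D E neg qc(1,3,2) K K' m pos])
  \<comment> \<open>A value of \<open>q\<close> other than \<open>0\<close> is detected by the integral over a triangle that contains the point.\<close>
  have "Z > 0"
  proof -
    obtain x where x: "x \<in> ?W" "q x \<noteq> 0" using nz by (auto simp: nonzero_on_def)
    then obtain L where L: "L \<in> P" "L \<subseteq> ?W" "x \<in> L" using W by (meson mesh_def)
    have "measure lebesgue L * (q x - 0)\<^sup>2 \<le> 34 * integral ?W (\<lambda>x. (q x - 0)\<^sup>2)"
      by (rule pressure_value_le[OF W qc(1,3) L])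
    moreover have "0 < measure lebesgue L * (q x - 0)\<^sup>2"
      using W L x by (auto simp: mesh_def)
    ultimately have "0 < Z\<^sup>2" unfolding Z_def sq by simp
    then show ?thesis using nonneg by (simp add: zero_less_power2)
  qed
  have "Z \<le> 100 * X \<or> Z \<le> 100 * Y"
  proof -
    have False if "10000 * X\<^sup>2 < Z\<^sup>2" "10000 * Y\<^sup>2 < Z\<^sup>2"
      using that Z_le zero_le_power2[of X] by (simp only: distrib_left)
    then have "Z\<^sup>2 \<le> 10000 * X\<^sup>2 \<or> Z\<^sup>2 \<le> 10000 * Y\<^sup>2"
      by (meson not_le)
    then have "Z\<^sup>2 \<le> (100 * X)\<^sup>2 \<or> Z\<^sup>2 \<le> (100 * Y)\<^sup>2"
      by (simp add: power_mult_distrib)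
    then show ?thesis
      using power2_le_imp_le[of Z "100 * X"] power2_le_imp_le[of Z "100 * Y"] nonneg by auto
  qed
  let ?S = "SUP v \<in> {v \<in> velocity_space P ?W. nonzero_on ?W v}.
    ereal (integral ?W (\<lambda>x. q x * divergence v x) / (H1_seminorm_on ?W v * L2_norm_on ?W q))"
  from \<open>Z \<le> 100 * X \<or> Z \<le> 100 * Y\<close>
  consider "Z \<le> 100 * X" | "Z \<le> 100 * Y" by blast
  then show "ereal (min b b' / 200) \<le> ?S"
  proof cases
    case 1
    have "ereal (b / (2 * 100)) \<le> ?S"
    proof (rule SUP_quotient_ge_of_part[OF D W _ _ pos(1) b q])
      fix L assume "L \<in> P"
      then show "L \<subseteq> D \<or> negligible (L \<inter> D)"
        using P(2) negligible_subset[OF neg, of "L \<inter> D"] by blast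
    qed (use 1 \<open>Z > 0\<close> in \<open>auto simp: X_def Z_def\<close>)
    then show ?thesis by (rule order_trans[rotated]) simp
  next
    case 2
    have "ereal (b' / (2 * 100)) \<le> ?S"
    proof (rule SUP_quotient_ge_of_part[OF E W _ _ pos(2) b' q])
      fix L assume "L \<in> P"
      then show "L \<subseteq> E \<or> negligible (L \<inter> E)"
        using P(2) negligible_subset[OF neg, of "L \<inter> E"] by blast
    qed (use 2 \<open>Z > 0\<close> in \<open>auto simp: Y_def Z_def\<close>)
    then show ?thesis by (rule order_trans[rotated]) simp
  qed
qed

section \<open>Geometry of corner patches\<close>

definition cell_lower :: "quadrant \<Rightarrow> (2 \<Rightarrow> real \<times> real) \<Rightarrow> real^2" where
  "cell_lower s I = (\<chi> i. if s i then fst (I i) else - snd (I i))"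

definition cell_upper :: "quadrant \<Rightarrow> (2 \<Rightarrow> real \<times> real) \<Rightarrow> real^2" where
  "cell_upper s I = (\<chi> i. if s i then snd (I i) else - fst (I i))"

lemma cell_eq_cbox: "cell s I = cbox (cell_lower s I) (cell_upper s I)"
proof -
  have "(fst (I i) \<le> (if s i then x $ i else - x $ i) \<and> (if s i then x $ i else - x $ i) \<le> snd (I i)) \<longleftrightarrow>
      cell_lower s I $ i \<le> x $ i \<and> x $ i \<le> cell_upper s I $ i" for x i
    unfolding cell_lower_def cell_upper_def vec_lambda_beta by (cases "s i") auto
  then show ?thesis by (simp only: cell_def set_eq_iff mem_box_cart mem_Collect_eq simp_thms)
qed

lemma measure_cell:
  assumes "\<And>i. fst (I i) \<le> snd (I i)"
  shows "measure lebesgue (cell s I) = (snd (I 1) - fst (I 1)) * (snd (I 2) - fst (I 2))"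
proof -
  have "cell_upper s I $ i - cell_lower s I $ i = snd (I i) - fst (I i)" for i
    by (simp add: cell_lower_def cell_upper_def)
  moreover have "cbox (cell_lower s I) (cell_upper s I) \<noteq> {}"
    using assms by (simp add: interval_ne_empty_cart cell_lower_def cell_upper_def)
  ultimately show ?thesis
    by (simp add: cell_eq_cbox content_cbox_cart UNIV_2)
qed

lemma rigid_motion_image:
  fixes f :: "real^2 \<Rightarrow> real^2"
  assumes f: "orthogonal_transformation f" and S: "compact S"
  shows compact_rigid_motion: "compact ((\<lambda>x. p + f x) ` S)"
    and measure_rigid_motion: "measure lebesgue ((\<lambda>x. p + f x) ` S) = measure lebesgue S"
proof -
  have "continuous_on S (\<lambda>x. p + f x)"
    using orthogonal_transformation_linear[OF f] by (intro continuous_intros linear_continuous_on)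
      (simp add: linear_conv_bounded_linear)
  then show "compact ((\<lambda>x. p + f x) ` S)" using S by (rule compact_continuous_image)
  have "measure lebesgue ((\<lambda>x. p + f x) ` S) = measure lebesgue ((+) p ` f ` S)"
    by (simp add: image_image)
  also have "\<dots> = measure lebesgue (f ` S)" by (rule measure_translation)
  also have "\<dots> = measure lebesgue S" by (rule measure_orthogonal_image[OF f lmeasurable_compact[OF S]])
  finally show "measure lebesgue ((\<lambda>x. p + f x) ` S) = measure lebesgue S" .
qed

lemma negligible_rigid_motion_Int:
  fixes f :: "real^2 \<Rightarrow> real^2"
  assumes f: "orthogonal_transformation f" and S: "compact S" "compact T" "negligible (S \<inter> T)"
  shows "negligible ((\<lambda>x. p + f x) ` S \<inter> (\<lambda>x. p + f x) ` T)"
proof -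
  have "inj (\<lambda>x. p + f x)"
    using orthogonal_transformation_inj[OF f] unfolding inj_def by simp
  then have eq: "(\<lambda>x. p + f x) ` S \<inter> (\<lambda>x. p + f x) ` T = (\<lambda>x. p + f x) ` (S \<inter> T)"
    by (rule image_Int[symmetric])
  have c: "compact (S \<inter> T)" using S by (intro compact_Int)
  show ?thesis
    unfolding eq negligible_iff_measure
    using lmeasurable_compact[OF compact_rigid_motion[OF f c]] measure_rigid_motion[OF f c] S(3)
    by (simp add: negligible_iff_measure)
qed

text \<open>
  Cells in different quadrants meet only on a coordinate axis. In the same quadrant, the line
  bounding the small cell in direction \<open>j\<close> separates an inner cell from one that is outer in
  that direction.
\<close>

lemma cell_overlap_negligible:
  assumes I: "\<And>i. I i \<in> inner_segments (H i (s i))"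
    and J: "\<And>i. J i \<in> inner_segments (H i (t i)) \<union> outer_segments (H i (t i))"
      "J j \<in> outer_segments (H j (t j))"
    and pos: "\<And>i. small (H i (s i)) > 0" "\<And>i. small (H i (t i)) > 0" "\<And>i. small (H i (t i)) < division (H i (t i))"
  shows "negligible (cell s I \<inter> cell t J)"
proof -
  have I_bounds: "0 \<le> fst (I i)" "snd (I i) \<le> small (H i (s i))" for i
    using I[of i] pos(1)[of i] by (auto simp: inner_segments_def split: if_splits)
  have J_bounds: "0 \<le> fst (J i)" for i
    using J(1)[of i] pos(2,3)[of i] by (auto simp: inner_segments_def outer_segments_def split: if_splits)
  have J_outer: "small (H j (t j)) \<le> fst (J j)"
    using J(2) pos(3)[of j] by (auto simp: outer_segments_def)
  have "\<exists>i c. cell s I \<inter> cell t J \<subseteq> {x. x $ i = c}"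
  proof (cases "s = t")
    case True
    have "cell s I \<inter> cell t J \<subseteq> {x. x $ j = (if s j then small (H j (s j)) else - small (H j (s j)))}"
    proof
      fix x assume x: "x \<in> cell s I \<inter> cell t J"
      let ?y = "if s j then x $ j else - x $ j"
      have "?y \<le> snd (I j)" "fst (J j) \<le> ?y" using x True by (auto simp: cell_def)
      then have "?y = small (H j (s j))" using I_bounds(2)[of j] J_outer True by simp
      then show "x \<in> {x. x $ j = (if s j then small (H j (s j)) else - small (H j (s j)))}"
        by (auto split: if_splits)
    qed
    then show ?thesis by blast
  next
    case False
    then obtain i where i: "s i \<noteq> t i" by blast
    have "cell s I \<inter> cell t J \<subseteq> {x. x $ i = 0}"
    proof
      fix x assume "x \<in> cell s I \<inter> cell t J"
      then have "fst (I i) \<le> (if s i then x $ i else - x $ i)" "fst (J i) \<le> (if t i then x $ i else - x $ i)"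
        by (auto simp: cell_def)
      then show "x \<in> {x. x $ i = 0}"
        using i I_bounds(1)[of i] J_bounds[of i] by (cases "s i") auto
    qed
    then show ?thesis by blast
  qed
  then obtain i c where "cell s I \<inter> cell t J \<subseteq> {x. x $ i = c}" by blast
  moreover have "{x :: real^2. x $ i = c} = {x. axis i 1 \<bullet> x = c}" by (simp add: inner_axis')
  then have "negligible {x :: real^2. x $ i = c}"
    using negligible_hyperplane[of "axis i 1 :: real^2" c] by (simp add: axis_eq_0_iff)
  ultimately show ?thesis by (rule negligible_subset[rotated])
qed

lemma finite_corner_rectangles: "finite (corner_rectangles \<phi> H S)"
  and finite_edge_rectangles: "finite (edge_rectangles \<phi> H S)"
proof -
  let ?seg = "\<lambda>s i. inner_segments (H i (s i)) \<union> outer_segments (H i (s i))"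
  let ?A = "\<Union>s. (\<lambda>I. \<phi> ` cell s I) ` {I. \<forall>i. I i \<in> ?seg s i}"
  have "finite {I. \<forall>i. I i \<in> ?seg s i}" for s :: quadrant
    using finite_PiE[of UNIV "?seg s"] by (simp add: PiE_UNIV_domain Pi_def inner_segments_def outer_segments_def)
  then have A: "finite ?A" by simp
  show "finite (corner_rectangles \<phi> H S)"
    by (rule finite_subset[OF _ A]) (auto simp: corner_rectangles_def)
  show "finite (edge_rectangles \<phi> H S)"
    by (rule finite_subset[OF _ A]) (auto simp: edge_rectangles_def)
qed

lemma triangulates_compact_convex:
  assumes "triangulates P R" "K \<in> P"
  shows "compact K" "convex K"
proof -
  have "2 simplex K" using assms by (auto simp: triangulates_def)
  then show "compact K" "convex K" by (auto intro: compact_simplex convex_simplex)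
qed

lemma triangulates_subset:
  assumes "triangulates P R" "K \<in> P"
  obtains Q where "Q \<in> R" "K \<subseteq> Q"
proof -
  have "\<forall>K\<in>P. \<exists>Q\<in>R. K \<subseteq> Q" using assms(1) unfolding triangulates_def by (elim conjE)
  then show ?thesis using assms(2) that by blast
qed

lemma triangulates_halves:
  assumes T: "triangulates P R" and Q: "Q \<in> R"
  obtains A B where "{T\<in>P. T \<subseteq> Q} = {A, B}" "A \<union> B = Q" "measure lebesgue A = measure lebesgue B"
proof -
  have "\<forall>Q\<in>R. \<exists>K L. K \<noteq> L \<and> {T\<in>P. T \<subseteq> Q} = {K, L} \<and> K \<union> L = Q \<and>
      measure lebesgue K = measure lebesgue L"
    using T unfolding triangulates_def by (elim conjE)
  from bspec[OF this Q] show ?thesis using that by (elim exE conjE)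
qed

lemma triangulates_split:
  assumes T: "triangulates P R" and Q: "Q \<in> R" and z: "z \<in> Q"
  shows "\<exists>K\<in>P. K \<subseteq> Q \<and> z \<in> K"
proof -
  obtain A B where AB: "{T\<in>P. T \<subseteq> Q} = {A, B}" "A \<union> B = Q"
    using triangulates_halves[OF T Q] .
  have "A \<in> {T\<in>P. T \<subseteq> Q}" "B \<in> {T\<in>P. T \<subseteq> Q}" by (simp_all only: AB(1) insert_iff simp_thms)
  moreover have "z \<in> A \<or> z \<in> B" using z AB(2) by auto
  ultimately show ?thesis by blast
qed

lemma triangulates_measure:
  assumes T: "triangulates P R" and Q: "Q \<in> R" and K: "K \<in> P" "K \<subseteq> Q"
  shows "measure lebesgue Q \<le> 2 * measure lebesgue K"
proof -
  obtain A B where AB: "{T\<in>P. T \<subseteq> Q} = {A, B}" "A \<union> B = Q" "measure lebesgue A = measure lebesgue B"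
    using triangulates_halves[OF T Q] .
  have "A \<in> {T\<in>P. T \<subseteq> Q}" "B \<in> {T\<in>P. T \<subseteq> Q}" by (simp_all only: AB(1) insert_iff simp_thms)
  moreover have "K \<in> {T\<in>P. T \<subseteq> Q}" using K by simp
  then have "K \<in> {A, B}" by (simp only: AB(1))
  ultimately have "A \<in> P" "B \<in> P" and K_eq: "K = A \<or> K = B" by simp_all
  then have "A \<in> sets lebesgue" "B \<in> sets lebesgue"
    using triangulates_compact_convex(1)[OF T] by (simp_all add: lmeasurable_compact fmeasurableD)
  then have "measure lebesgue (A \<union> B) \<le> measure lebesgue A + measure lebesgue B"
    by (rule measure_Un_le)
  then show ?thesis using AB(2,3) K_eq by auto
qed

lemma triangulates_mesh:
  assumes T: "triangulates P R" and R': "R' \<subseteq> R" and pos: "\<And>Q. Q \<in> R \<Longrightarrow> measure lebesgue Q > 0"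
  shows "mesh P (\<Union>R')"
  unfolding mesh_def
proof (intro conjI ballI impI)
  show "finite {K \<in> P. K \<subseteq> \<Union>R'}" using T by (simp add: triangulates_def triangulation_def)
next
  fix x assume "x \<in> \<Union>R'"
  then obtain Q where Q: "Q \<in> R'" "x \<in> Q" by blast
  then obtain K where "K \<in> P" "K \<subseteq> Q" "x \<in> K" using triangulates_split[OF T] R' by blast
  then show "\<exists>K\<in>P. K \<subseteq> \<Union>R' \<and> x \<in> K" using Q by blast
next
  fix K assume K: "K \<in> P"
  then show "compact K" "convex K" using triangulates_compact_convex[OF T] by auto
  obtain Q where "Q \<in> R" "K \<subseteq> Q" using triangulates_subset[OF T K] .
  then show "measure lebesgue K > 0"
    using triangulates_measure[OF T \<open>Q \<in> R\<close> K] pos[OF \<open>Q \<in> R\<close>] by simp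
qed

lemma corner_patch_rigid:
  assumes "corner_patch \<kappa> \<phi> H S"
  obtains p f where "orthogonal_transformation f" "\<phi> = (\<lambda>x. p + f x)"
proof -
  have "\<exists>p f. orthogonal_transformation f \<and> \<phi> = (\<lambda>x. p + f x)"
    using assms unfolding corner_patch_def by (elim conjE)
  then show ?thesis by (elim exE conjE) (rule that)
qed

lemma corner_patch_nonempty: "corner_patch \<kappa> \<phi> H S \<Longrightarrow> S \<noteq> {}"
  unfolding corner_patch_def by (elim conjE)

lemma corner_patchD:
  assumes "corner_patch \<kappa> \<phi> H S" "s \<in> S"
  shows "0 < small (H i (s i))" "small (H i (s i)) < division (H i (s i))"
    "division (H i (s i)) < extent (H i (s i))"
proof -
  note D = bspec[OF conjunct1[OF conjunct2[OF conjunct2[OF assms(1)[unfolded corner_patch_def]]]] assms(2)]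
  have "shape_regular \<kappa> (small (H 1 (s 1))) (small (H 2 (s 2)))" using D by (elim conjE)
  then show "0 < small (H i (s i))" using exhaust_2[of i] by (auto simp: shape_regular_def)
  have "\<forall>i. small (H i (s i)) < division (H i (s i)) \<and> division (H i (s i)) < extent (H i (s i))"
    using D by (elim conjE)
  then show "small (H i (s i)) < division (H i (s i))" "division (H i (s i)) < extent (H i (s i))"
    by simp_all
qed

lemma segment_length_pos:
  assumes "corner_patch \<kappa> \<phi> H S" "s \<in> S"
    "I i \<in> inner_segments (H i (s i)) \<union> outer_segments (H i (s i))"
  shows "fst (I i) < snd (I i)"
proof -
  have "I i \<in> {(0, small (H i (s i)) / 2), (small (H i (s i)) / 2, small (H i (s i))), (0, small (H i (s i))),
      (small (H i (s i)), division (H i (s i))), (division (H i (s i)), extent (H i (s i)))}"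
    using assms(3) by (auto simp: inner_segments_def outer_segments_def split: if_splits)
  then show ?thesis using corner_patchD[OF assms(1,2), of i] by auto
qed

lemma patch_rectangle_pos:
  assumes c: "corner_patch \<kappa> \<phi> H S" and Q: "Q \<in> corner_rectangles \<phi> H S \<union> edge_rectangles \<phi> H S"
  shows "measure lebesgue Q > 0"
proof -
  obtain p f where f: "orthogonal_transformation f" and \<phi>: "\<phi> = (\<lambda>x. p + f x)"
    using corner_patch_rigid[OF c] .
  obtain s I where Q: "Q = \<phi> ` cell s I" and s: "s \<in> S"
    and I: "\<And>i. I i \<in> inner_segments (H i (s i)) \<union> outer_segments (H i (s i))"
    using Q unfolding corner_rectangles_def edge_rectangles_def by blast
  have l: "fst (I i) < snd (I i)" for i using segment_length_pos[OF c s] I by blast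
  have "measure lebesgue Q = measure lebesgue (cell s I)"
    unfolding Q \<phi> by (intro measure_rigid_motion f) (simp add: cell_eq_cbox)
  also have "\<dots> = (snd (I 1) - fst (I 1)) * (snd (I 2) - fst (I 2))"
    using l by (intro measure_cell less_imp_le)
  also have "\<dots> > 0" using l by simp
  finally show ?thesis .
qed

lemma corner_edge_negligible:
  assumes c: "corner_patch \<kappa> \<phi> H S"
  shows "negligible (corner_region \<phi> H S \<inter> edge_region \<phi> H S)"
proof -
  obtain p f where f: "orthogonal_transformation f" and \<phi>: "\<phi> = (\<lambda>x. p + f x)"
    using corner_patch_rigid[OF c] .
  have "negligible (Q \<inter> Q')" if Q: "Q \<in> corner_rectangles \<phi> H S" "Q' \<in> edge_rectangles \<phi> H S" for Q Q'
  proof -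
    obtain s I where Q1: "Q = \<phi> ` cell s I" "s \<in> S" "\<forall>i. I i \<in> inner_segments (H i (s i))"
      using Q(1) unfolding corner_rectangles_def by blast
    obtain t J where Q2: "Q' = \<phi> ` cell t J" "t \<in> S"
      "\<forall>i. J i \<in> inner_segments (H i (t i)) \<union> outer_segments (H i (t i))"
      "\<exists>i. J i \<in> outer_segments (H i (t i))"
      using Q(2) unfolding edge_rectangles_def by blast
    have "negligible (cell s I \<inter> cell t J)"
      using cell_overlap_negligible[of I H s J t] Q1(3) Q2(3,4)
        corner_patchD(1,2)[OF c Q1(2)] corner_patchD(1,2)[OF c Q2(2)] by blast
    then show ?thesis
      unfolding Q1(1) Q2(1) \<phi> by (intro negligible_rigid_motion_Int f) (simp_all add: cell_eq_cbox)
  qed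
  then have "negligible (\<Union>(Q, Q')\<in>corner_rectangles \<phi> H S \<times> edge_rectangles \<phi> H S. Q \<inter> Q')"
    by (intro negligible_Union finite_imageI finite_cartesian_product finite_corner_rectangles
        finite_edge_rectangles) auto
  moreover have "corner_region \<phi> H S \<inter> edge_region \<phi> H S =
      (\<Union>(Q, Q')\<in>corner_rectangles \<phi> H S \<times> edge_rectangles \<phi> H S. Q \<inter> Q')"
    unfolding corner_region_def edge_region_def by blast
  ultimately show ?thesis by simp
qed

text \<open>
  There are at most four quadrants, so the corner region is at most four times as large as its
  largest small cell.
\<close>

lemma measure_corner_region_le:
  assumes c: "corner_patch \<kappa> \<phi> H S"
  obtains s where "s \<in> S"
    "measure lebesgue (corner_region \<phi> H S) \<le> 4 * (small (H 1 (s 1)) * small (H 2 (s 2)))"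
proof -
  define a where "a = (\<lambda>s :: quadrant. small (H 1 (s 1)) * small (H 2 (s 2)))"
  obtain p f where f: "orthogonal_transformation f" and \<phi>: "\<phi> = (\<lambda>x. p + f x)"
    using corner_patch_rigid[OF c] .
  have "Max (a ` S) \<in> a ` S" using corner_patch_nonempty[OF c] by (intro Max_in) auto
  then obtain s where s: "s \<in> S" "a s = Max (a ` S)" by auto
  have le: "a t \<le> a s" if "t \<in> S" for t using that by (simp add: s)
  let ?I = "\<lambda>t i. (0, small (H i (t i)))"
  have cpt: "compact (\<phi> ` cell t J)" for t J
    unfolding \<phi> by (intro compact_rigid_motion f) (simp add: cell_eq_cbox)
  have m: "measure lebesgue (\<phi> ` cell t (?I t)) = a t" if "t \<in> S" for t
  proof -
    have "measure lebesgue (\<phi> ` cell t (?I t)) = measure lebesgue (cell t (?I t))"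
      unfolding \<phi> by (intro measure_rigid_motion f) (simp add: cell_eq_cbox)
    then show ?thesis
      using corner_patchD(1)[OF c that] by (simp add: measure_cell less_imp_le a_def)
  qed
  have "corner_region \<phi> H S \<subseteq> (\<Union>t\<in>S. \<phi> ` cell t (?I t))"
  proof -
    have "cell t I \<subseteq> cell t (?I t)" if "t \<in> S" "\<And>i. I i \<in> inner_segments (H i (t i))" for t I
    proof -
      have I: "0 \<le> fst (I i) \<and> snd (I i) \<le> small (H i (t i))" for i
        using that(2)[of i] corner_patchD(1)[OF c that(1), of i] by (auto simp: inner_segments_def split: if_splits)
      show ?thesis
      proof
        fix x assume x: "x \<in> cell t I"
        have "fst (I i) \<le> (if t i then x $ i else - x $ i) \<and> (if t i then x $ i else - x $ i) \<le> snd (I i)" for i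
          using x unfolding cell_def by blast
        then have "0 \<le> (if t i then x $ i else - x $ i) \<and> (if t i then x $ i else - x $ i) \<le> small (H i (t i))" for i
          using I by (meson order_trans)
        then show "x \<in> cell t (?I t)" unfolding cell_def fst_conv snd_conv by blast
      qed
    qed
    then show ?thesis unfolding corner_region_def corner_rectangles_def by blast
  qed
  moreover have "corner_region \<phi> H S \<in> sets lebesgue"
    unfolding corner_region_def
    using finite_corner_rectangles cpt
    by (intro sets.finite_Union) (auto simp: corner_rectangles_def intro!: fmeasurableD lmeasurable_compact)
  moreover have "compact (\<Union>t\<in>S. \<phi> ` cell t (?I t))"
    using cpt by (intro compact_UN) auto
  ultimately have "measure lebesgue (corner_region \<phi> H S) \<le> measure lebesgue (\<Union>t\<in>S. \<phi> ` cell t (?I t))"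
    by (intro measure_mono_fmeasurable lmeasurable_compact)
  also have "\<dots> \<le> (\<Sum>t\<in>S. measure lebesgue (\<phi> ` cell t (?I t)))"
    using cpt by (intro measure_UNION_le fmeasurableD lmeasurable_compact) auto
  also have "\<dots> \<le> (\<Sum>t\<in>S. a s)" using m le by (intro sum_mono) auto
  also have "\<dots> = real (card S) * a s" by simp
  also have "\<dots> \<le> 4 * a s"
  proof (rule mult_right_mono)
    have "card S \<le> card (UNIV :: quadrant set)" by (intro card_mono) auto
    then show "real (card S) \<le> 4" by (simp add: card_fun)
    show "0 \<le> a s" using corner_patchD(1)[OF c s(1)] by (simp add: a_def less_imp_le)
  qed
  finally show ?thesis using that s(1) by (simp add: a_def)
qed

text \<open>
  Let \<open>h 1\<close> and \<open>h 2\<close> be the side lengths of the largest small cell, so that the corner region has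
  area at most \<open>4 * h 1 * h 2\<close>. The rectangle \<open>I\<close> of this cell at its outer corner \<open>z\<close> has at
  least half the side length in each direction. The rectangle \<open>J\<close> of the large cell at \<open>z\<close> has
  the sides of the elements that the division cuts off the two adjacent thin cells; each exceeds
  the width of its element, which is at least half of the length of the small cell in the other
  direction. So both rectangles have area at least \<open>h 1 * h 2 / 4\<close>, and their triangles half of that.
\<close>

lemma corner_edge_common_point:
  assumes c: "corner_patch \<kappa> \<phi> H S" and d: "thin_cells_divided H S"
    and T: "triangulates P (corner_rectangles \<phi> H S \<union> edge_rectangles \<phi> H S)"
  obtains K K' z where "K \<in> P" "K \<subseteq> corner_region \<phi> H S" "z \<in> K"
    "K' \<in> P" "K' \<subseteq> edge_region \<phi> H S" "z \<in> K'"
    "measure lebesgue (corner_region \<phi> H S) \<le> 32 * measure lebesgue K"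
    "measure lebesgue (corner_region \<phi> H S) \<le> 32 * measure lebesgue K'"
proof -
  obtain p f where f: "orthogonal_transformation f" and \<phi>: "\<phi> = (\<lambda>x. p + f x)"
    using corner_patch_rigid[OF c] .
  obtain s where s: "s \<in> S"
    and m: "measure lebesgue (corner_region \<phi> H S) \<le> 4 * (small (H 1 (s 1)) * small (H 2 (s 2)))"
    using measure_corner_region_le[OF c] .
  define h where "h = (\<lambda>i. small (H i (s i)))"
  define I where "I = (\<lambda>i. if bisected (H i (s i)) then (h i / 2, h i) else (0, h i))"
  define J where "J = (\<lambda>i. (h i, division (H i (s i))))"
  define z where "z = \<phi> (\<chi> i. if s i then h i else - h i)"
  have h: "0 < h i" "h i < division (H i (s i))" for i
    using corner_patchD[OF c s] by (simp_all add: h_def)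
  have I: "I i \<in> inner_segments (H i (s i))" for i by (simp add: I_def inner_segments_def h_def)
  have J: "J i \<in> outer_segments (H i (s i))" for i by (simp add: J_def outer_segments_def h_def)
  have Il: "h i / 2 \<le> snd (I i) - fst (I i)" for i
    using h(1)[of i] by (simp add: I_def)
  \<comment> \<open>The thin element that is outer in direction \<open>i\<close> and inner in direction \<open>j\<close> links the two lengths.\<close>
  have Jl: "h j / 2 \<le> snd (J i) - fst (J i)" if "i \<noteq> j" for i j
  proof -
    have "long_and_thin (snd (J i) - fst (J i)) (snd (I j) - fst (I j))"
      using d s that I[of j] J[of i] unfolding thin_cells_divided_def by fastforce
    then show ?thesis using Il[of j] by (simp add: long_and_thin_def)
  qed
  have meas: "measure lebesgue (\<phi> ` cell s A) = (snd (A 1) - fst (A 1)) * (snd (A 2) - fst (A 2))"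
    if "\<And>i. fst (A i) \<le> snd (A i)" for A
  proof -
    have "measure lebesgue (\<phi> ` cell s A) = measure lebesgue (cell s A)"
      unfolding \<phi> by (intro measure_rigid_motion f) (simp add: cell_eq_cbox)
    then show ?thesis using measure_cell[OF that] by simp
  qed
  have QI: "\<phi> ` cell s I \<in> corner_rectangles \<phi> H S"
    using s I unfolding corner_rectangles_def by blast
  have QJ: "\<phi> ` cell s J \<in> edge_rectangles \<phi> H S"
    using s J unfolding edge_rectangles_def by blast
  have "z \<in> \<phi> ` cell s I" "z \<in> \<phi> ` cell s J"
  proof -
    let ?z = "(\<chi> i. if s i then h i else - h i) :: real^2"
    have eq: "(if s i then ?z $ i else - ?z $ i) = h i" for i by simp
    have "fst (I i) \<le> h i \<and> h i \<le> snd (I i)" for i using h(1)[of i] by (simp add: I_def)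
    then have "?z \<in> cell s I" unfolding cell_def mem_Collect_eq eq by blast
    moreover have "fst (J i) \<le> h i \<and> h i \<le> snd (J i)" for i using h(2)[of i] by (simp add: J_def)
    then have "?z \<in> cell s J" unfolding cell_def mem_Collect_eq eq by blast
    ultimately show "z \<in> \<phi> ` cell s I" "z \<in> \<phi> ` cell s J" by (simp_all add: z_def)
  qed
  then obtain K K' where K: "K \<in> P" "K \<subseteq> \<phi> ` cell s I" "z \<in> K"
    and K': "K' \<in> P" "K' \<subseteq> \<phi> ` cell s J" "z \<in> K'"
    using triangulates_split[OF T] QI QJ by (meson UnI1 UnI2)
  have "h 1 / 2 * (h 2 / 2) \<le> (snd (I 1) - fst (I 1)) * (snd (I 2) - fst (I 2))"
    using h by (intro mult_mono Il) (simp_all add: I_def less_imp_le)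
  also have "\<dots> = measure lebesgue (\<phi> ` cell s I)"
    using meas[of I] h(1) by (simp add: I_def less_imp_le)
  finally have "h 1 / 2 * (h 2 / 2) \<le> measure lebesgue (\<phi> ` cell s I)" .
  then have mK: "h 1 * h 2 \<le> 8 * measure lebesgue K"
    using triangulates_measure[OF T UnI1[OF QI] K(1,2)] by simp
  have "h 2 / 2 * (h 1 / 2) \<le> (snd (J 1) - fst (J 1)) * (snd (J 2) - fst (J 2))"
    using h by (intro mult_mono Jl) (simp_all add: J_def less_imp_le)
  also have "\<dots> = measure lebesgue (\<phi> ` cell s J)"
    using meas[of J] h(2) by (simp add: J_def less_imp_le)
  finally have "h 2 / 2 * (h 1 / 2) \<le> measure lebesgue (\<phi> ` cell s J)" .
  then have mK': "h 1 * h 2 \<le> 8 * measure lebesgue K'"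
    using triangulates_measure[OF T UnI2[OF QJ] K'(1,2)] by (simp add: mult.commute)
  show ?thesis
  proof (rule that[of K z K'])
    show "K \<subseteq> corner_region \<phi> H S" using K(2) QI unfolding corner_region_def by blast
    show "K' \<subseteq> edge_region \<phi> H S" using K'(2) QJ unfolding edge_region_def by blast
    show "measure lebesgue (corner_region \<phi> H S) \<le> 32 * measure lebesgue K"
      using m mK by (simp add: h_def)
    show "measure lebesgue (corner_region \<phi> H S) \<le> 32 * measure lebesgue K'"
      using m mK' by (simp add: h_def)
  qed (use K K' in auto)
qed

theorem mainTheorem4:
  fixes \<beta> \<beta>\<^sub>c :: real
  assumes "\<beta> > 0" and "\<beta>\<^sub>c > 0"
  shows "\<exists>\<beta>\<^sub>P>0. \<forall>\<kappa> \<phi> H S P.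
           corner_patch \<kappa> \<phi> H S \<longrightarrow>
           triangulates P (corner_rectangles \<phi> H S \<union> edge_rectangles \<phi> H S) \<longrightarrow>
           inf_sup_stable P (corner_region \<phi> H S) \<beta>\<^sub>c \<longrightarrow>
           thin_cells_divided H S \<longrightarrow>
           inf_sup_stable P (edge_region \<phi> H S) \<beta> \<longrightarrow>
           ereal \<beta>\<^sub>P \<le> inf_sup P (corner_region \<phi> H S \<union> edge_region \<phi> H S)"
proof (intro exI[of _ "min \<beta>\<^sub>c \<beta> / 200"] conjI allI impI)
  show "0 < min \<beta>\<^sub>c \<beta> / 200" using assms by simp
  fix \<kappa> \<phi> H S P
  let ?R = "corner_rectangles \<phi> H S \<union> edge_rectangles \<phi> H S"
  assume c: "corner_patch \<kappa> \<phi> H S" and T: "triangulates P ?R"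
    and corner: "inf_sup_stable P (corner_region \<phi> H S) \<beta>\<^sub>c"
    and d: "thin_cells_divided H S"
    and edge: "inf_sup_stable P (edge_region \<phi> H S) \<beta>"
  obtain K K' z where K: "K \<in> P" "K \<subseteq> corner_region \<phi> H S" "z \<in> K"
    and K': "K' \<in> P" "K' \<subseteq> edge_region \<phi> H S" "z \<in> K'"
    and m: "measure lebesgue (corner_region \<phi> H S) \<le> 32 * measure lebesgue K"
    "measure lebesgue (corner_region \<phi> H S) \<le> 32 * measure lebesgue K'"
    using corner_edge_common_point[OF c d T] .
  have fin: "finite P" using T by (simp add: triangulates_def triangulation_def)
  have mesh: "mesh P (corner_region \<phi> H S)" "mesh P (edge_region \<phi> H S)"
    unfolding corner_region_def edge_region_def
    by (auto intro!: triangulates_mesh[OF T _ patch_rectangle_pos[OF c]])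
  have part: "L \<subseteq> corner_region \<phi> H S \<or> L \<subseteq> edge_region \<phi> H S" if L: "L \<in> P" for L
  proof -
    obtain Q where "Q \<in> ?R" "L \<subseteq> Q" using triangulates_subset[OF T L] .
    then show ?thesis unfolding corner_region_def edge_region_def by blast
  qed
  show "ereal (min \<beta>\<^sub>c \<beta> / 200) \<le> inf_sup P (corner_region \<phi> H S \<union> edge_region \<phi> H S)"
    by (rule inf_sup_union[OF mesh fin part corner_edge_negligible[OF c] K K' m assms(2) corner assms(1) edge])
qed

end
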